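(* Let $\mu$ be $\sigma$-finite, let $1<p<\infty$, and let $q$ be the conjugate exponent of $p$. Let $\{\Lambda_\omega\}_{\omega\in\Omega}$ be a Bochner $pg$-frame for $X$ with respect to $\{H_\omega\}_{\omega\in\Omega}$ with synthesis operator $T$ and analysis operator $U$. Then the following statements are equivalent: (i) $\{\Lambda_\omega\}_{\omega\in\Omega}$ is a Bochner $qg$-Riesz basis for $X^*$ (with respect to $\{H_\omega\}_{\omega\in\Omega}$). (ii) $T$ is injective. (iii) $R_U=L^p(\mu,\oplus_{\omega\in\Omega}H_\omega)$, where $R_U$ denotes the range of $U$.
   Context: $X$ is a Banach space, $(\Omega,\Sigma,\mu)$ is a measure space with $\mu$ a positive measure, and $\{H_\omega\}_{\omega\in\Omega}$ is a family of Hilbert spaces. $B(X,H_\omega)$ is the space of bounded linear operators from $X$ to $H_\omega$. Put $K=\oplus_{\omega\in\Omega}H_\omega$ (Hilbert space direct sum), with each $H_\omega$ regarded as a subspace of $K$. A function $f$ from $\Omega$ to a Banach space is Bochner measurable if there are simple functions $f_n$ with $\|f_n(\omega)-f(\omega)\|\to0$ for $\mu$-a.e. $\omega$. For $1\le r<\infty$, $L^r(\mu,K)$ is the Bochner space of (classes of) Bochner measurable $F:\Omega\to K$ with $\|F\|_r=(\int_\Omega\|F(\omega)\|^r d\mu(\omega))^{1/r}<\infty$. Pairing: $\nu:K\to K^*$ is a fixed isometric (linear) isomorphism between $K$ and $K^*$, and for $u,v\in K$, $\langle u,v\rangle:=\nu(v)(u)$ (not the inner product). For $F\in L^p(\mu,K)$,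 $G\in L^q(\mu,K)$ with $\frac1p+\frac1q=1$, $\langle F,G\rangle:=\int_\Omega\langle F(\omega),G(\omega)\rangle d\mu(\omega)$; this identifies $L^q(\mu,K)$ isometrically with $(L^p(\mu,K))^*$. For $x\in X$, $x^*\in X^*$, $\langle x,x^*\rangle=x^*(x)$. Bochner $pg$-frame ($1<p<\infty$): a family $\{\Lambda_\omega\in B(X,H_\omega)\}_{\omega\in\Omega}$ is a Bochner $pg$-frame for $X$ with respect to $\{H_\omega\}_{\omega\in\Omega}$ if (i) for each $x\in X$, $\omega\mapsto\Lambda_\omega(x)$ is Bochner measurable, and (ii) there are positive constants $A,B$ with $A\|x\|\le(\int_\Omega\|\Lambda_\omega(x)\|^p d\mu(\omega))^{1/p}\le B\|x\|$ for all $x\in X$. The synthesis operator $T:L^q(\mu,K)\to X^*$ and the analysis operator $U:X\to L^p(\mu,K)$ are defined by $\langle x,TG\rangle=\int_\Omega\langle\Lambda_\omega(x),G(\omega)\rangle d\mu(\omega)=\langle Ux,G\rangle$ for $x\in X$, $G\in L^q(\mu,K)$ (they are well-defined and bounded for a Bochner $pg$-frame). Bochner $qg$-Riesz basis ($1<q<\infty$): a family $\{\Lambda_\omega\in B(X,H_\omega)\}_{\omega\in\Omega}$ is a Bochner $qg$-Riesz basis for $X^*$ with respect to $\{H_\omega\}_{\omega\in\Omega}$ if (i) $\{x\in X:\Lambda_\omega x=0\ \text{for }\mu\text{-a.e. }\omega\}=\{0\}$; and (ii) for each $x\in X$, $\omega\mapsto\Lambda_\omega(x)$ is Bochner measurable,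 the operator $T:L^q(\mu,K)\to X^*$, $\langle x,TG\rangle=\int_\Omega\langle\Lambda_\omega(x),G(\omega)\rangle d\mu(\omega)$, is well-defined, and there are positive constants $A,B$ with $A\|G\|_q\le\|TG\|\le B\|G\|_q$ for all $G\in L^q(\mu,K)$. *)

theory Defs
  imports "HOL-Analysis.Analysis"
begin

text \<open>
  The scalar field is a type \<open>'f\<close> of sort \<open>{real_normed_field, euclidean_space}\<close>. Both
  \<^typ>\<open>real\<close> and \<^typ>\<open>complex\<close> have this sort, and by the Gelfand--Mazur theorem every type of this
  sort is isometrically isomorphic to one of them, so real and complex scalars are covered at once.
  The library type classes only provide the underlying real structure of a normed space; the
  multiplication by scalars of \<open>'f\<close> is an explicit parameter.
\<close>

locale normed_space_over = vector_space scale
  for scale :: "'f::{real_normed_field,euclidean_space} \<Rightarrow> 'v::real_normed_vector \<Rightarrow> 'v" +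
  assumes scale_of_real: "scale (of_real r) v = r *\<^sub>R v"
    and norm_scale: "norm (scale a v) = norm a * norm v"

text \<open>
  Complex conjugation: \<open>inner a 1\<close> is the real part of \<open>a\<close>, so \<open>conjugate a\<close> is
  \<open>2 * Re a - a\<close>; on the reals it is the identity.
\<close>

definition conjugate :: "'f::{real_normed_field,euclidean_space} \<Rightarrow> 'f" where
  "conjugate a = of_real (2 * inner a 1) - a"

lemma conjugate_complex: "conjugate z = cnj z"
  by (simp add: conjugate_def complex_eq_iff inner_complex_def)

lemma conjugate_real: "conjugate x = (x::real)"
  by (simp add: conjugate_def)

locale hilbert_space_over = normed_space_over scale
  for scale :: "'f::{real_normed_field,euclidean_space} \<Rightarrow> 'k::banach \<Rightarrow> 'k" +
  fixes ip :: "'k \<Rightarrow> 'k \<Rightarrow> 'f"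
  assumes ip_add_left: "ip (u + v) w = ip u w + ip v w"
    and ip_scale_left: "ip (scale a u) w = a * ip u w"
    and ip_conjugate: "ip v u = conjugate (ip u v)"
    and ip_self: "ip u u = of_real ((norm u)\<^sup>2)"

lemma normed_space_over_real: "normed_space_over ((*\<^sub>R) :: real \<Rightarrow> 'v::real_normed_vector \<Rightarrow> 'v)"
  by unfold_locales (auto simp: algebra_simps)

lemma hilbert_space_over_real:
  "hilbert_space_over ((*\<^sub>R) :: real \<Rightarrow> 'k::{real_inner,banach} \<Rightarrow> 'k) inner"
  by unfold_locales
    (auto simp: algebra_simps conjugate_real inner_commute power2_norm_eq_inner)

lemma hilbert_space_over_complex:
  "hilbert_space_over ((*) :: complex \<Rightarrow> complex \<Rightarrow> complex) (\<lambda>u v. u * cnj v)"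
  by unfold_locales
    (auto simp: algebra_simps conjugate_complex norm_mult scaleR_conv_of_real
      complex_mult_cnj cmod_power2 simp del: of_real_power)

text \<open>
  \<open>K\<close> is the Hilbert space direct sum of the \<open>H i\<close>, \<open>i \<in> I\<close>, each being regarded as a subspace
  of \<open>K\<close> (the whole type \<open>'k\<close>).
\<close>

definition hilbert_direct_sum ::
  "('f::{real_normed_field,euclidean_space} \<Rightarrow> 'k::banach \<Rightarrow> 'k) \<Rightarrow> ('k \<Rightarrow> 'k \<Rightarrow> 'f) \<Rightarrow>
    'w set \<Rightarrow> ('w \<Rightarrow> 'k set) \<Rightarrow> bool" where
  "hilbert_direct_sum scK ip I H \<longleftrightarrow>
     (\<forall>i\<in>I. module.subspace scK (H i) \<and> closed (H i)) \<and>
     (\<forall>i\<in>I. \<forall>j\<in>I. i \<noteq> j \<longrightarrow> (\<forall>u\<in>H i. \<forall>v\<in>H j. ip u v = 0)) \<and>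
     closure (module.span scK (\<Union>i\<in>I. H i)) = UNIV"

definition bounded_operators ::
  "('f::{real_normed_field,euclidean_space} \<Rightarrow> 'x::real_normed_vector \<Rightarrow> 'x) \<Rightarrow>
    ('f \<Rightarrow> 'y::real_normed_vector \<Rightarrow> 'y) \<Rightarrow> ('x \<Rightarrow> 'y) set" where
  "bounded_operators scX scY = {A. bounded_linear A \<and> Vector_Spaces.linear scX scY A}"

definition dual_space ::
  "('f::{real_normed_field,euclidean_space} \<Rightarrow> 'x::real_normed_vector \<Rightarrow> 'x) \<Rightarrow> ('x \<Rightarrow> 'f) set"
  where "dual_space scX = bounded_operators scX (*)"

definition isometric_dual_isomorphism ::
  "('f::{real_normed_field,euclidean_space} \<Rightarrow> 'k::real_normed_vector \<Rightarrow> 'k) \<Rightarrow>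
    ('k \<Rightarrow> 'k \<Rightarrow> 'f) \<Rightarrow> bool" where
  "isometric_dual_isomorphism scK \<nu> \<longleftrightarrow>
     bij_betw \<nu> UNIV (dual_space scK) \<and>
     (\<forall>u v. \<nu> (u + v) = (\<lambda>k. \<nu> u k + \<nu> v k)) \<and>
     (\<forall>a u. \<nu> (scK a u) = (\<lambda>k. a * \<nu> u k)) \<and>
     (\<forall>u. onorm (\<nu> u) = norm u)"

text \<open>
  The library's Bochner integral only treats second countable spaces, whereas \<open>K\<close> may be
  non-separable.
\<close>

definition bochner_measurable :: "'w measure \<Rightarrow> ('w \<Rightarrow> 'k::real_normed_vector) \<Rightarrow> bool" where
  "bochner_measurable M F \<longleftrightarrow>
     (\<exists>s. (\<forall>n::nat. simple_function M (s n)) \<and>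
          (AE \<omega> in M. (\<lambda>n. norm (s n \<omega> - F \<omega>)) \<longlonglongrightarrow> 0))"

text \<open>
  A Bochner measurable function is only an almost everywhere limit of simple functions, so
  scalar functions derived from it are measurable with respect to the completion of the measure,
  but not necessarily with respect to the measure itself. All integrals are therefore taken with
  respect to \<open>completion M\<close>.
\<close>

definition Lfun :: "real \<Rightarrow> 'w measure \<Rightarrow> ('w \<Rightarrow> 'k::real_normed_vector) set" where
  "Lfun r M = {F. bochner_measurable M F \<and>
     (\<integral>\<^sup>+ \<omega>. ennreal (norm (F \<omega>) powr r) \<partial>completion M) < \<infinity>}"

definition Lnorm :: "real \<Rightarrow> 'w measure \<Rightarrow> ('w \<Rightarrow> 'k::real_normed_vector) \<Rightarrow> real" where
  "Lnorm r M F = enn2real (\<integral>\<^sup>+ \<omega>. ennreal (norm (F \<omega>) powr r) \<partial>completion M) powr (1 / r)"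

definition ae_equal ::
  "real \<Rightarrow> 'w measure \<Rightarrow> (('w \<Rightarrow> 'k::real_normed_vector) \<times> ('w \<Rightarrow> 'k)) set" where
  "ae_equal r M = {(F, G). F \<in> Lfun r M \<and> G \<in> Lfun r M \<and> (AE \<omega> in M. F \<omega> = G \<omega>)}"

definition Lspace :: "real \<Rightarrow> 'w measure \<Rightarrow> ('w \<Rightarrow> 'k::real_normed_vector) set set" where
  "Lspace r M = Lfun r M // ae_equal r M"

definition rep :: "('w \<Rightarrow> 'k) set \<Rightarrow> 'w \<Rightarrow> 'k" where
  "rep \<F> = (SOME F. F \<in> \<F>)"

text \<open>
  The pairings are bilinear: \<open>\<langle>u, v\<rangle> = \<nu> v u\<close>, and for classes \<open>\<F>\<close> in \<open>L\<^sup>p\<close> and \<open>\<G>\<close> in \<open>L\<^sup>q\<close>,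
  \<open>\<langle>\<F>, \<G>\<rangle>\<close> is the integral of \<open>\<langle>F \<omega>, G \<omega>\<rangle>\<close>, which does not depend on the representatives.
\<close>

definition Lpairing ::
  "'w measure \<Rightarrow> ('k \<Rightarrow> 'k \<Rightarrow> 'f::{real_normed_field,euclidean_space}) \<Rightarrow>
    ('w \<Rightarrow> 'k) set \<Rightarrow> ('w \<Rightarrow> 'k) set \<Rightarrow> 'f" where
  "Lpairing M \<nu> \<F> \<G> = (\<integral>\<omega>. \<nu> (rep \<G> \<omega>) (rep \<F> \<omega>) \<partial>completion M)"

definition synthesis ::
  "'w measure \<Rightarrow> ('k \<Rightarrow> 'k \<Rightarrow> 'f::{real_normed_field,euclidean_space}) \<Rightarrow> ('w \<Rightarrow> 'x \<Rightarrow> 'k) \<Rightarrow>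
    ('w \<Rightarrow> 'k) set \<Rightarrow> 'x \<Rightarrow> 'f" where
  "synthesis M \<nu> \<Lambda> \<G> = (\<lambda>x. \<integral>\<omega>. \<nu> (rep \<G> \<omega>) (\<Lambda> \<omega> x) \<partial>completion M)"

text \<open>
  \<open>analysis p q M \<nu> \<Lambda> x\<close> is the element \<open>U x\<close> of \<open>L\<^sup>p\<close> determined by \<open>\<langle>U x, \<G>\<rangle> = \<langle>x, T \<G>\<rangle>\<close> for
  all \<open>\<G>\<close> in \<open>L\<^sup>q\<close>, that is, the class of \<open>\<lambda>\<omega>. \<Lambda> \<omega> x\<close>.
\<close>

definition analysis ::
  "real \<Rightarrow> real \<Rightarrow> 'w measure \<Rightarrow>
    ('k::real_normed_vector \<Rightarrow> 'k \<Rightarrow> 'f::{real_normed_field,euclidean_space}) \<Rightarrow>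
    ('w \<Rightarrow> 'x \<Rightarrow> 'k) \<Rightarrow> 'x \<Rightarrow> ('w \<Rightarrow> 'k) set" where
  "analysis p q M \<nu> \<Lambda> x =
     (THE \<F>. \<F> \<in> Lspace p M \<and>
        (\<forall>\<G>\<in>Lspace q M. Lpairing M \<nu> \<F> \<G> = synthesis M \<nu> \<Lambda> \<G> x))"

definition operator_family ::
  "'w measure \<Rightarrow> ('f::{real_normed_field,euclidean_space} \<Rightarrow> 'x::real_normed_vector \<Rightarrow> 'x) \<Rightarrow>
    ('f \<Rightarrow> 'k::real_normed_vector \<Rightarrow> 'k) \<Rightarrow> ('w \<Rightarrow> 'k set) \<Rightarrow> ('w \<Rightarrow> 'x \<Rightarrow> 'k) \<Rightarrow> bool" where
  "operator_family M scX scK H \<Lambda> \<longleftrightarrow>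
     (\<forall>\<omega>\<in>space M. \<Lambda> \<omega> \<in> bounded_operators scX scK \<and> range (\<Lambda> \<omega>) \<subseteq> H \<omega>)"

definition bochner_pg_frame ::
  "real \<Rightarrow> 'w measure \<Rightarrow> ('f::{real_normed_field,euclidean_space} \<Rightarrow> 'x::banach \<Rightarrow> 'x) \<Rightarrow>
    ('f \<Rightarrow> 'k::banach \<Rightarrow> 'k) \<Rightarrow> ('w \<Rightarrow> 'k set) \<Rightarrow> ('w \<Rightarrow> 'x \<Rightarrow> 'k) \<Rightarrow> bool" where
  "bochner_pg_frame p M scX scK H \<Lambda> \<longleftrightarrow>
     operator_family M scX scK H \<Lambda> \<and>
     (\<forall>x. bochner_measurable M (\<lambda>\<omega>. \<Lambda> \<omega> x)) \<and>
     (\<exists>A>0. \<exists>B>0. \<forall>x. (\<lambda>\<omega>. \<Lambda> \<omega> x) \<in> Lfun p M \<and>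
        A * norm x \<le> Lnorm p M (\<lambda>\<omega>. \<Lambda> \<omega> x) \<and> Lnorm p M (\<lambda>\<omega>. \<Lambda> \<omega> x) \<le> B * norm x)"

definition synthesis_well_defined ::
  "real \<Rightarrow> 'w measure \<Rightarrow> ('f::{real_normed_field,euclidean_space} \<Rightarrow> 'x::banach \<Rightarrow> 'x) \<Rightarrow>
    ('k::banach \<Rightarrow> 'k \<Rightarrow> 'f) \<Rightarrow> ('w \<Rightarrow> 'x \<Rightarrow> 'k) \<Rightarrow> bool" where
  "synthesis_well_defined q M scX \<nu> \<Lambda> \<longleftrightarrow>
     (\<forall>G\<in>Lfun q M. \<forall>x. integrable (completion M) (\<lambda>\<omega>. \<nu> (G \<omega>) (\<Lambda> \<omega> x))) \<and>
     (\<forall>\<G>\<in>Lspace q M. synthesis M \<nu> \<Lambda> \<G> \<in> dual_space scX)"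

definition bochner_qg_riesz_basis ::
  "real \<Rightarrow> 'w measure \<Rightarrow> ('f::{real_normed_field,euclidean_space} \<Rightarrow> 'x::banach \<Rightarrow> 'x) \<Rightarrow>
    ('f \<Rightarrow> 'k::banach \<Rightarrow> 'k) \<Rightarrow> ('w \<Rightarrow> 'k set) \<Rightarrow> ('k \<Rightarrow> 'k \<Rightarrow> 'f) \<Rightarrow>
    ('w \<Rightarrow> 'x \<Rightarrow> 'k) \<Rightarrow> bool" where
  "bochner_qg_riesz_basis q M scX scK H \<nu> \<Lambda> \<longleftrightarrow>
     operator_family M scX scK H \<Lambda> \<and>
     {x. AE \<omega> in M. \<Lambda> \<omega> x = 0} = {0} \<and>
     (\<forall>x. bochner_measurable M (\<lambda>\<omega>. \<Lambda> \<omega> x)) \<and>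
     synthesis_well_defined q M scX \<nu> \<Lambda> \<and>
     (\<exists>A>0. \<exists>B>0. \<forall>\<G>\<in>Lspace q M.
        A * Lnorm q M (rep \<G>) \<le> onorm (synthesis M \<nu> \<Lambda> \<G>) \<and>
        onorm (synthesis M \<nu> \<Lambda> \<G>) \<le> B * Lnorm q M (rep \<G>))"

end

theory Submission
  imports Defs
begin

text \<open>
  The implications form the cycle Riesz basis \<open>\<Longrightarrow>\<close> \<open>T\<close> injective \<open>\<Longrightarrow>\<close> \<open>U\<close> surjective \<open>\<Longrightarrow>\<close> Riesz basis.

  The link between the two exponents is the duality map. Let \<open>J\<close> send \<open>u \<in> K\<close> to the element
  with \<open>\<nu> (J u) = ip (\<cdot>, u)\<close>. For \<open>F \<in> L\<^sup>p\<close> the function \<open>F\<^sup>\<circ> = |F|\<^sup>p\<^sup>-\<^sup>2 J F\<close> lies in \<open>L\<^sup>q\<close> and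
  \<open>\<langle>F, F\<^sup>\<circ>\<rangle>\<close> is the integral of \<open>|F|\<^sup>p\<close>. Hence \<open>L\<^sup>q\<close> separates the points of \<open>L\<^sup>p\<close>, which
  identifies \<open>U x\<close> with the class of \<open>\<omega> \<mapsto> \<Lambda> \<omega> x\<close> (\<open>analysis_eq\<close>).

  \<open>T\<close> injective implies \<open>U\<close> surjective (\<open>analysis_surj_if_synthesis_inj\<close>). Given \<open>F \<in> L\<^sup>p\<close>, the
  norm distance from \<open>F\<close> to the range of \<open>U\<close> is attained: by uniform convexity (in a pointwise
  form, integrated over \<open>\<Omega>\<close>) the functions \<open>U x\<^sub>n\<close> of a minimizing sequence are Cauchy, so by the
  lower frame bound the \<open>x\<^sub>n\<close> are Cauchy in \<open>X\<close>, and their limit \<open>x\<close> is a minimizer. At a minimizer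
  the derivative of \<open>\<integral>|F - U y|\<^sup>p\<close> vanishes, and for \<open>W = F - U x\<close> this says \<open>\<langle>U h, W\<^sup>\<circ>\<rangle> = 0\<close> for
  every \<open>h\<close>, that is, \<open>T W\<^sup>\<circ> = 0\<close>. Injectivity gives \<open>W\<^sup>\<circ> = 0\<close>, hence \<open>W = 0\<close> and \<open>F = U x\<close>.

  \<open>U\<close> surjective implies the Riesz basis property (\<open>riesz_basis_if_analysis_surj\<close>). For \<open>G \<in> L\<^sup>q\<close>
  put \<open>F = |G|\<^sup>q\<^sup>-\<^sup>2 J\<^sup>-\<^sup>1 G\<close> and write \<open>F = U x\<close>. Then \<open>(T G) x = \<parallel>G\<parallel>\<^sup>q\<close>, while the frame bound bounds
  \<open>\<parallel>x\<parallel>\<close> by a multiple of \<open>\<parallel>F\<parallel> = \<parallel>G\<parallel>\<^sup>q\<^sup>/\<^sup>p\<close>; this is the lower estimate for \<open>\<parallel>T G\<parallel>\<close>. The upper one is Hoelder's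
  inequality. The remaining implication follows from the lower
  estimate, as \<open>T\<close> is linear.
\<close>

section \<open>Uniform convexity in three real parameters\<close>

text \<open>
  By the mean value theorem on the two halves of \<open>[s, t]\<close>: the derivative of \<open>x\<^sup>p\<close> is strictly
  larger on the right half. The derivative is only used in the interior, so \<open>s = 0\<close> is covered.
\<close>

lemma powr_midpoint_less:
  fixes p s t :: real
  assumes p: "1 < p" and s: "0 \<le> s" and st: "s < t"
  shows "((s + t) / 2) powr p < (s powr p + t powr p) / 2"
proof -
  define m where "m = (s + t) / 2"
  have sm: "s < m" and mt: "m < t" and half: "m - s = t - m"
    using st by (auto simp: m_def field_simps)
  have der: "((\<lambda>x. x powr p) has_real_derivative p * x powr (p - 1)) (at x)" if "0 < x" for x
    using that by (intro has_real_derivative_powr)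
  have cont: "continuous_on {a..b} (\<lambda>x. x powr p)" if "0 \<le> a" for a b :: real
    using that p by (intro continuous_on_powr') auto
  have mv: "\<exists>z>a. z < b \<and> b powr p - a powr p = (b - a) * (p * z powr (p - 1))"
    if "0 \<le> a" "a < b" for a b :: real
    using MVT[OF \<open>a < b\<close> cont[OF \<open>0 \<le> a\<close>]] der that
    by (smt (verit) DERIV_unique real_differentiable_def)
  obtain x where x: "s < x" "x < m" "m powr p - s powr p = (m - s) * (p * x powr (p - 1))"
    using mv[OF s sm] by auto
  obtain y where y: "m < y" "y < t" "t powr p - m powr p = (t - m) * (p * y powr (p - 1))"
    using mv[of m t] s sm mt by auto
  have "x powr (p - 1) < y powr (p - 1)"
    using x y s p by (intro powr_less_mono2) auto
  then have "(m - s) * (p * x powr (p - 1)) < (t - m) * (p * y powr (p - 1))"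
    unfolding half using p mt by (intro mult_strict_left_mono) auto
  then have "m powr p - s powr p < t powr p - m powr p"
    unfolding x(3) y(3) .
  then show ?thesis
    unfolding m_def[symmetric] by argo
qed

text \<open>
  For vectors \<open>u\<close>, \<open>v\<close> of a Hilbert space with \<open>|u| = s\<close>, \<open>|v| = t\<close> and \<open>|u - v| = d\<close>, the
  parallelogram law says that the square root below is \<open>|(u + v) / 2|\<close>. Uniform convexity of the
  \<open>p\<close>-th power of a Hilbert norm is thereby a question about three real numbers. The strictness
  comes from the convexity of \<open>x\<^sup>p\<close> if \<open>s \<noteq> t\<close>, and from \<open>d > 0\<close> if \<open>s = t\<close>.
\<close>

lemma median_powr_less:
  fixes p s t d :: real
  assumes p: "1 < p" and s: "0 \<le> s" "0 \<le> t" and d: "\<bar>s - t\<bar> \<le> d" "d \<le> s + t" "0 < d"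
  shows "sqrt ((s\<^sup>2 + t\<^sup>2) / 2 - d\<^sup>2 / 4) powr p < (s powr p + t powr p) / 2"
proof (cases "s = t")
  case True
  have "d\<^sup>2 \<le> (2 * s)\<^sup>2" using d True by (intro power_mono) auto
  moreover have "0 < d\<^sup>2" using d by simp
  ultimately have "0 \<le> (s\<^sup>2 + t\<^sup>2) / 2 - d\<^sup>2 / 4" "sqrt ((s\<^sup>2 + t\<^sup>2) / 2 - d\<^sup>2 / 4) < sqrt (s\<^sup>2)"
    using True by (auto simp: power_mult_distrib simp del: real_sqrt_abs)
  then show ?thesis using True s p
    by (auto intro!: powr_less_mono2)
next
  case False
  have "(s - t)\<^sup>2 \<le> d\<^sup>2" using power_mono[OF d(1) abs_ge_zero, of 2] by simp
  moreover have "d\<^sup>2 \<le> (s + t)\<^sup>2" using d s by (intro power_mono) auto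
  moreover have "(s - t)\<^sup>2 + (s + t)\<^sup>2 = 2 * (s\<^sup>2 + t\<^sup>2)" by (simp add: power2_eq_square algebra_simps)
  moreover have "((s + t) / 2)\<^sup>2 = (s + t)\<^sup>2 / 4" by (simp add: power_divide)
  moreover have "0 \<le> (s - t)\<^sup>2" by simp
  ultimately have "0 \<le> (s\<^sup>2 + t\<^sup>2) / 2 - d\<^sup>2 / 4" "(s\<^sup>2 + t\<^sup>2) / 2 - d\<^sup>2 / 4 \<le> ((s + t) / 2)\<^sup>2"
    by argo+
  moreover from this have "sqrt ((s\<^sup>2 + t\<^sup>2) / 2 - d\<^sup>2 / 4) \<le> (s + t) / 2"
    using s by (intro real_le_lsqrt) simp_all
  ultimately have "sqrt ((s\<^sup>2 + t\<^sup>2) / 2 - d\<^sup>2 / 4) powr p \<le> ((s + t) / 2) powr p"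
    using p by (intro powr_mono2) simp_all
  also have "\<dots> < (s powr p + t powr p) / 2"
    using False powr_midpoint_less[OF p, of s t] powr_midpoint_less[OF p, of t s] s
    by (cases "s < t") (auto simp: add.commute)
  finally show ?thesis .
qed

text \<open>
  On the compact set of admissible triples with \<open>d\<^sup>p \<ge> \<epsilon>\<close> the convexity gap is continuous and
  positive, hence bounded below by some \<open>\<delta> > 0\<close>. There \<open>d\<^sup>p \<le> 2\<^sup>p\<close> is absorbed by
  \<open>2\<^sup>p / \<delta>\<close> times the gap; off this set the term \<open>\<epsilon>\<close> alone suffices.
\<close>

lemma powr_uniform_convexity_normalized:
  fixes p \<epsilon> :: real
  assumes p: "1 < p" and \<epsilon>: "0 < \<epsilon>"
  obtains C where "0 < C"
    "\<And>s t d. \<lbrakk>0 \<le> s; 0 \<le> t; \<bar>s - t\<bar> \<le> d; d \<le> s + t; s powr p + t powr p = 1\<rbrakk> \<Longrightarrow>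
       d powr p \<le> \<epsilon> + C * (1 / 2 - sqrt ((s\<^sup>2 + t\<^sup>2) / 2 - d\<^sup>2 / 4) powr p)"
proof -
  define gap where "gap s t d = 1 / 2 - sqrt ((s\<^sup>2 + t\<^sup>2) / 2 - d\<^sup>2 / 4) powr p" for s t d :: real
  define S where "S = ({0..1} \<times> {0..1} \<times> {0..2}) \<inter> {(s, t, d). \<bar>s - t\<bar> \<le> d \<and> d \<le> s + t} \<inter>
     {x \<in> {0..1} \<times> {0..1} \<times> {0..2}. fst x powr p + fst (snd x) powr p = 1 \<and> \<epsilon> \<le> snd (snd x) powr p}"
  have nn: "0 \<le> (s\<^sup>2 + t\<^sup>2) / 2 - d\<^sup>2 / 4" if "0 \<le> s" "0 \<le> t" "\<bar>s - t\<bar> \<le> d" "d \<le> s + t" for s t d :: real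
  proof -
    have "d\<^sup>2 \<le> (s + t)\<^sup>2" using that by (intro power_mono) auto
    also have "\<dots> \<le> 2 * (s\<^sup>2 + t\<^sup>2)"
      using sum_squares_ge_zero[of "s - t" 0] by (simp add: power2_eq_square algebra_simps)
    finally show ?thesis by simp
  qed
  have box: "compact ({0..1} \<times> {0..1} \<times> {0..2} :: (real \<times> real \<times> real) set)"
    by (intro compact_Times compact_Icc)
  have "closed {(s, t, d). \<bar>s - t\<bar> \<le> d \<and> d \<le> s + (t::real)}"
    unfolding case_prod_unfold
    by (intro closed_Collect_conj closed_Collect_le continuous_intros)
  moreover have "closed {x \<in> {0..1} \<times> {0..1} \<times> {0..2::real}.
      fst x powr p + fst (snd x) powr p = 1 \<and> \<epsilon> \<le> snd (snd x) powr p}"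
  proof -
    have c: "continuous_on ({0..1} \<times> {0..1} \<times> {0..2::real}) (\<lambda>x. fst x powr p + fst (snd x) powr p)"
      "continuous_on ({0..1::real} \<times> {0..1::real} \<times> {0..2::real}) (\<lambda>x. snd (snd x) powr p)"
      using p by (auto intro!: continuous_intros continuous_on_powr')
    have "closed ({0..1} \<times> {0..1} \<times> {0..2} \<inter> (\<lambda>x::real\<times>real\<times>real. fst x powr p + fst (snd x) powr p) -` {1})"
      "closed ({0..1} \<times> {0..1} \<times> {0..2} \<inter> (\<lambda>x::real\<times>real\<times>real. snd (snd x) powr p) -` {\<epsilon>..})"
      by (intro continuous_closed_preimage c compact_imp_closed[OF box] closed_atLeast closed_singleton)+
    then show ?thesis
      by (rule back_subst[of closed, OF closed_Int]) auto
  qed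
  ultimately have cS: "compact S"
    unfolding S_def using box by (intro compact_Int_closed)
  have contS: "continuous_on S (\<lambda>(s, t, d). gap s t d)"
    unfolding gap_def case_prod_unfold using p nn
    by (intro continuous_intros continuous_on_powr') (auto simp: S_def)
  have gap_pos: "0 < gap s t d" if "0 \<le> s" "0 \<le> t" "\<bar>s - t\<bar> \<le> d" "d \<le> s + t" "s powr p + t powr p = 1"
    "0 < d" for s t d
    using median_powr_less[OF p that(1-4) \<open>0 < d\<close>] that(5) unfolding gap_def by simp
  have "\<exists>\<delta>>0. \<forall>(s, t, d)\<in>S. \<delta> \<le> gap s t d"
  proof (cases "S = {}")
    case False
    then obtain z where z: "z \<in> S" "\<forall>x\<in>S. (\<lambda>(s, t, d). gap s t d) z \<le> (\<lambda>(s, t, d). gap s t d) x"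
      using continuous_attains_inf[OF cS False contS] by blast
    obtain s t d where zeq: "z = (s, t, d)" by (cases z)
    have "0 \<le> s" "0 \<le> t" "\<bar>s - t\<bar> \<le> d" "d \<le> s + t" "s powr p + t powr p = 1" "0 \<le> d" "\<epsilon> \<le> d powr p"
      using z(1) by (auto simp: S_def zeq)
    moreover from this have "d \<noteq> 0" using \<epsilon> by auto
    ultimately have "0 < gap s t d" by (intro gap_pos) auto
    then show ?thesis using z(2) zeq by auto
  next
    case True
    show ?thesis unfolding True by (rule exI[of _ 1]) simp
  qed
  then obtain \<delta> where \<delta>: "0 < \<delta>" "\<And>s t d. (s, t, d) \<in> S \<Longrightarrow> \<delta> \<le> gap s t d" by blast
  have "d powr p \<le> \<epsilon> + 2 powr p / \<delta> * gap s t d"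
    if st: "0 \<le> s" "0 \<le> t" "\<bar>s - t\<bar> \<le> d" "d \<le> s + t" "s powr p + t powr p = 1" for s t d
  proof -
    have le1: "u \<le> 1" if "0 \<le> u" "u powr p \<le> 1" for u
    proof (rule ccontr)
      assume "\<not> u \<le> 1"
      then have "1 powr p < u powr p" using p by (intro powr_less_mono2) auto
      with that show False by simp
    qed
    have "s powr p \<le> 1" "t powr p \<le> 1"
      using st(5) powr_ge_zero[of s p] powr_ge_zero[of t p] by linarith+
    then have "s \<le> 1" "t \<le> 1" using le1 st(1,2) by blast+
    show ?thesis
    proof (cases "\<epsilon> \<le> d powr p")
      case True
      then have "(s, t, d) \<in> S" using st \<open>s \<le> 1\<close> \<open>t \<le> 1\<close> by (auto simp: S_def)
      then have "1 \<le> gap s t d / \<delta>" using \<delta> by (simp add: field_simps)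
      then have "2 powr p * 1 \<le> 2 powr p * (gap s t d / \<delta>)" by (intro mult_left_mono) auto
      moreover have "d powr p \<le> 2 powr p"
        using st \<open>s \<le> 1\<close> \<open>t \<le> 1\<close> p by (intro powr_mono2) auto
      ultimately show ?thesis using \<epsilon> by simp
    next
      case False
      have "0 \<le> gap s t d"
      proof (cases "d = 0")
        case True
        then show ?thesis using st by (auto simp: gap_def)
      next
        case False
        then have "0 < d" using st(3) abs_ge_zero[of "s - t"] by linarith
        then show ?thesis using gap_pos[OF st] by linarith
      qed
      then have "0 \<le> 2 powr p / \<delta> * gap s t d" using \<delta> by auto
      then show ?thesis using False by simp
    qed
  qed
  then show thesis
    using \<delta>(1) by (intro that[of "2 powr p / \<delta>"]) (auto simp: gap_def)
qed

text \<open>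
  All terms are homogeneous of degree \<open>p\<close> in \<open>(s, t, d)\<close>, so the normalization
  \<open>s\<^sup>p + t\<^sup>p = 1\<close> is no restriction.
\<close>

lemma powr_uniform_convexity:
  fixes p \<epsilon> :: real
  assumes p: "1 < p" and \<epsilon>: "0 < \<epsilon>"
  obtains C where "0 < C"
    "\<And>s t d. \<lbrakk>0 \<le> s; 0 \<le> t; \<bar>s - t\<bar> \<le> d; d \<le> s + t\<rbrakk> \<Longrightarrow>
       d powr p \<le> \<epsilon> * (s powr p + t powr p)
         + C * ((s powr p + t powr p) / 2 - sqrt ((s\<^sup>2 + t\<^sup>2) / 2 - d\<^sup>2 / 4) powr p)"
proof -
  obtain C where C: "0 < C"
    "\<And>s t d. \<lbrakk>0 \<le> s; 0 \<le> t; \<bar>s - t\<bar> \<le> d; d \<le> s + t; s powr p + t powr p = 1\<rbrakk> \<Longrightarrow>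
       d powr p \<le> \<epsilon> + C * (1 / 2 - sqrt ((s\<^sup>2 + t\<^sup>2) / 2 - d\<^sup>2 / 4) powr p)"
    using powr_uniform_convexity_normalized[OF assms] by blast
  have "d powr p \<le> \<epsilon> * (s powr p + t powr p)
         + C * ((s powr p + t powr p) / 2 - sqrt ((s\<^sup>2 + t\<^sup>2) / 2 - d\<^sup>2 / 4) powr p)"
    if st: "0 \<le> s" "0 \<le> t" "\<bar>s - t\<bar> \<le> d" "d \<le> s + t" for s t d
  proof (cases "s = 0 \<and> t = 0")
    case True
    then show ?thesis using st by simp
  next
    case False
    define R where "R = s powr p + t powr p"
    define r where "r = R powr (1 / p)"
    have R: "0 < R" using False st unfolding R_def
      by (metis add_nonneg_pos add_pos_nonneg powr_ge_zero powr_gt_zero)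
    then have r: "0 < r" and rp: "r powr p = R" using p by (auto simp: r_def powr_powr)
    have scl: "(x / r) powr p = x powr p / R" if "0 \<le> x" for x
      using that r rp by (simp add: powr_divide)
    have m: "0 \<le> sqrt ((s\<^sup>2 + t\<^sup>2) / 2 - d\<^sup>2 / 4)"
    proof -
      have "d\<^sup>2 \<le> (s + t)\<^sup>2" using st by (intro power_mono) auto
      also have "\<dots> \<le> 2 * (s\<^sup>2 + t\<^sup>2)"
        using sum_squares_ge_zero[of "s - t" 0] by (simp add: power2_eq_square algebra_simps)
      finally show ?thesis by simp
    qed
    have "((s/r)\<^sup>2 + (t/r)\<^sup>2) / 2 - (d/r)\<^sup>2 / 4 = ((s\<^sup>2 + t\<^sup>2) / 2 - d\<^sup>2 / 4) / r\<^sup>2"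
      by (simp add: power_divide diff_divide_distrib add_divide_distrib)
    then have sq: "sqrt (((s/r)\<^sup>2 + (t/r)\<^sup>2) / 2 - (d/r)\<^sup>2 / 4) = sqrt ((s\<^sup>2 + t\<^sup>2) / 2 - d\<^sup>2 / 4) / r"
      using r by (simp add: real_sqrt_divide)
    have "(d/r) powr p \<le> \<epsilon> + C * (1 / 2 - sqrt (((s/r)\<^sup>2 + (t/r)\<^sup>2) / 2 - (d/r)\<^sup>2 / 4) powr p)"
    proof (rule C(2))
      show "\<bar>s / r - t / r\<bar> \<le> d / r"
        using st(3) r by (simp add: diff_divide_distrib[symmetric] abs_divide divide_right_mono)
      show "d / r \<le> s / r + t / r"
        using st(4) r by (simp add: add_divide_distrib[symmetric] divide_right_mono)
      show "(s / r) powr p + (t / r) powr p = 1"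
        using R st by (simp add: scl add_divide_distrib[symmetric] R_def)
    qed (use st r in auto)
    then have "d powr p / R \<le> \<epsilon> + C * (1 / 2 - sqrt ((s\<^sup>2 + t\<^sup>2) / 2 - d\<^sup>2 / 4) powr p / R)"
      unfolding sq using scl[OF m] scl[of d] st by auto
    then have "R * (d powr p / R) \<le> R * (\<epsilon> + C * (1 / 2 - sqrt ((s\<^sup>2 + t\<^sup>2) / 2 - d\<^sup>2 / 4) powr p / R))"
      using R by (intro mult_left_mono) auto
    then show ?thesis
      using R by (simp add: R_def[symmetric] algebra_simps)
  qed
  then show thesis using C(1) that by blast
qed

section \<open>Hilbert spaces over the scalar field\<close>

lemma conjugate_add: "conjugate (a + b) = conjugate a + conjugate b"
  by (simp add: conjugate_def inner_add_left algebra_simps)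

lemma inner_of_real_one: "inner (of_real r :: 'f::{real_normed_field,euclidean_space}) 1 = r"
  by (simp add: of_real_def dot_square_norm)

lemma conjugate_of_real_mult:
  "conjugate (of_real r * a) = of_real r * (conjugate a :: 'f::{real_normed_field,euclidean_space})"
proof -
  have "inner (of_real r * a) 1 = r * inner a 1"
    by (metis inner_scaleR_left scaleR_conv_of_real)
  then show ?thesis by (simp add: conjugate_def algebra_simps)
qed

lemma inner_conjugate_one: "inner (conjugate a) 1 = inner (a::'f::{real_normed_field,euclidean_space}) 1"
  by (simp add: conjugate_def inner_diff_left inner_of_real_one del: of_real_mult)

context hilbert_space_over
begin

lemma ip_add_right: "ip u (v + w) = ip u v + ip u w"
  by (metis ip_add_left ip_conjugate conjugate_add)

lemma ip_scaleR_left: "ip (r *\<^sub>R u) v = of_real r * ip u v"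
  by (metis ip_scale_left scale_of_real)

lemma ip_scaleR_right: "ip u (r *\<^sub>R v) = of_real r * ip u v"
  by (metis ip_scaleR_left ip_conjugate conjugate_of_real_mult)

lemma ip_minus_left: "ip (- u) v = - ip u v"
  using ip_scaleR_left[of "-1" u v] by simp

lemma ip_minus_right: "ip u (- v) = - ip u v"
  using ip_scaleR_right[of u "-1" v] by simp

lemma Re_ip_commute: "inner (ip u v) 1 = inner (ip v u) 1"
  by (metis inner_conjugate_one ip_conjugate)

lemma Re_ip_self: "inner (ip u u) 1 = (norm u)\<^sup>2"
  unfolding ip_self by (rule inner_of_real_one)

lemma norm_add_square: "(norm (u + v))\<^sup>2 = (norm u)\<^sup>2 + (norm v)\<^sup>2 + 2 * inner (ip u v) 1"
  using Re_ip_self[of "u + v"] Re_ip_commute[of v u]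
  by (simp add: ip_add_left ip_add_right inner_add_left Re_ip_self)

lemma parallelogram:
  fixes u v :: 'k
  shows "(norm (u + v))\<^sup>2 + (norm (u - v))\<^sup>2 = 2 * (norm u)\<^sup>2 + 2 * (norm v)\<^sup>2"
  using norm_add_square[of u v] norm_add_square[of u "- v"]
  by (simp add: ip_minus_right)

text \<open>
  In view of \<open>norm_add_square\<close> this is the triangle inequality squared.
\<close>

lemma Re_ip_le: "inner (ip u v) 1 \<le> norm u * norm v"
proof -
  have "(norm (u + v))\<^sup>2 \<le> (norm u + norm v)\<^sup>2"
    by (intro power_mono norm_triangle_ineq) auto
  then show ?thesis using norm_add_square[of u v] by (simp add: power2_sum)
qed

text \<open>
  The scalar field is only known to be a normed field with a Euclidean norm, so this identity of
  the complex numbers has to be read off from the inner product: both sides, multiplied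
  by \<open>|u|\<^sup>2\<close>, equal \<open>ip (a u) (a u)\<close>. The factor can be cancelled if \<open>u \<noteq> 0\<close>.
\<close>

lemma mult_conjugate:
  fixes u :: 'k and a :: 'f
  assumes "u \<noteq> 0"
  shows "a * conjugate a = of_real ((norm a)\<^sup>2)"
proof -
  have "of_real ((norm a)\<^sup>2) * of_real ((norm u)\<^sup>2) = ip (scale a u) (scale a u)"
    by (simp add: ip_self norm_scale power_mult_distrib)
  also have "\<dots> = a * conjugate (ip (scale a u) u)"
    by (metis ip_scale_left ip_conjugate)
  also have "conjugate (ip (scale a u) u) = of_real ((norm u)\<^sup>2) * conjugate a"
    unfolding ip_scale_left ip_self by (metis conjugate_of_real_mult mult.commute)
  finally show ?thesis using assms by (simp add: algebra_simps)
qed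

text \<open>
  Multiplying \<open>u\<close> by \<open>conjugate (ip u v)\<close> turns \<open>ip u v\<close> into its squared modulus, to which the
  bound on the real part applies.
\<close>

lemma Cauchy_Schwarz: "norm (ip u v) \<le> norm u * norm v"
proof (cases "u = 0")
  case True
  then have "ip u v = 0" using ip_scaleR_left[of 0 u v] by simp
  then show ?thesis using True by simp
next
  case False
  define a where "a = ip u v"
  have m: "a * conjugate a = of_real ((norm a)\<^sup>2)" by (rule mult_conjugate[OF False])
  then have "norm a * norm (conjugate a) = norm a * norm a"
    by (metis norm_mult norm_of_real power2_eq_square abs_power2)
  then have na: "norm (conjugate a) = norm a \<or> a = 0" by auto
  have "(norm a)\<^sup>2 = inner (ip (scale (conjugate a) u) v) 1"
    by (metis ip_scale_left m a_def mult.commute inner_of_real_one)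
  also have "\<dots> \<le> norm (conjugate a) * norm u * norm v"
    using Re_ip_le[of "scale (conjugate a) u" v] by (simp add: norm_scale)
  finally show ?thesis using na unfolding a_def[symmetric]
    by (cases "a = 0") (auto simp: power2_eq_square mult.assoc)
qed

lemma ip_in_dual: "(\<lambda>v. ip v u) \<in> dual_space scale"
proof -
  have "bounded_linear (\<lambda>v. ip v u)"
    by (rule bounded_linear_intro[where K = "norm u"])
      (auto simp: ip_add_left ip_scaleR_left scaleR_conv_of_real Cauchy_Schwarz)
  moreover have "Vector_Spaces.linear scale (*) (\<lambda>v. ip v u)"
    by (unfold_locales) (auto simp: algebra_simps ip_add_left ip_scale_left)
  ultimately show ?thesis by (simp add: dual_space_def bounded_operators_def)
qed

lemma onorm_ip: "onorm (\<lambda>v. ip v u) = norm u"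
proof (rule antisym)
  show "onorm (\<lambda>v. ip v u) \<le> norm u"
    by (rule onorm_bound) (auto simp: Cauchy_Schwarz mult.commute)
  have "norm u * norm u \<le> onorm (\<lambda>v. ip v u) * norm u"
    using onorm[of "\<lambda>v. ip v u" u] ip_in_dual[of u]
    by (auto simp: dual_space_def bounded_operators_def ip_self power2_eq_square norm_mult)
  then show "norm u \<le> onorm (\<lambda>v. ip v u)"
    by (cases "u = 0") (auto simp: onorm_pos_le
        ip_in_dual[unfolded dual_space_def bounded_operators_def, simplified])
qed

text \<open>
  The constant does not depend on \<open>u\<close> and \<open>v\<close>, so the inequality can be integrated. If the
  integrals of \<open>|u|\<^sup>p\<close>, \<open>|v|\<^sup>p\<close> and \<open>|(u + v) / 2|\<^sup>p\<close> are nearly equal, then that of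
  \<open>|u - v|\<^sup>p\<close> is small: this is the uniform convexity of \<open>L\<^sup>p\<close>.
\<close>

lemma norm_uniform_convexity:
  assumes "1 < p" "0 < \<epsilon>"
  obtains C where "0 < C"
    "\<And>u v :: 'k. norm (u - v) powr p \<le> \<epsilon> * (norm u powr p + norm v powr p)
       + C * ((norm u powr p + norm v powr p) / 2 - norm ((1/2) *\<^sub>R (u + v)) powr p)"
proof -
  obtain C where C: "0 < C"
    "\<And>s t d. \<lbrakk>0 \<le> s; 0 \<le> t; \<bar>s - t\<bar> \<le> d; d \<le> s + t\<rbrakk> \<Longrightarrow>
       d powr p \<le> \<epsilon> * (s powr p + t powr p)
         + C * ((s powr p + t powr p) / 2 - sqrt ((s\<^sup>2 + t\<^sup>2) / 2 - d\<^sup>2 / 4) powr p)"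
    using powr_uniform_convexity[OF assms] by blast
  have "norm ((1/2) *\<^sub>R (u + v)) = sqrt (((norm u)\<^sup>2 + (norm v)\<^sup>2) / 2 - (norm (u - v))\<^sup>2 / 4)" for u v :: 'k
  proof -
    have "(norm ((1/2) *\<^sub>R (u + v)))\<^sup>2 = ((norm u)\<^sup>2 + (norm v)\<^sup>2) / 2 - (norm (u - v))\<^sup>2 / 4"
      using parallelogram[of u v] by (simp add: power_divide) argo
    then show ?thesis by (metis norm_ge_zero real_sqrt_unique)
  qed
  then show thesis
    using C(1) C(2)[OF norm_ge_zero norm_ge_zero norm_triangle_ineq3 norm_triangle_ineq4]
    by (intro that[of C]) auto
qed

text \<open>
  The derivative of \<open>|\<cdot>|\<^sup>p\<close> at \<open>w\<close> is \<open>p |w|\<^sup>p\<^sup>-\<^sup>2 Re ip (\<cdot>, w)\<close>, and a convex function lies above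
  its tangents. The proof is Young's inequality for \<open>|u|\<close> and \<open>|w|\<^sup>p\<^sup>-\<^sup>1\<close>.
\<close>

lemma powr_subgradient:
  assumes p: "1 < p"
  shows "norm w powr p + p * (norm w powr (p - 2) * inner (ip (u - w) w) 1) \<le> norm u powr p"
proof (cases "w = 0")
  case True
  then show ?thesis by simp
next
  case False
  define q where "q = p / (p - 1)"
  have q: "1 < q" "1 / p + 1 / q = 1" "p / q = p - 1" "(p - 1) * q = p"
    using p by (auto simp: q_def field_simps)
  have e: "norm w powr (p - 2) * (norm w)\<^sup>2 = norm w powr p"
    "norm w powr (p - 2) * norm w = norm w powr (p - 1)"
    using False powr_add[of "norm w" "p - 2" 2] powr_add[of "norm w" "p - 2" 1] by auto
  have "inner (ip (u - w) w) 1 = inner (ip u w) 1 - (norm w)\<^sup>2"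
    using ip_add_left[of u "- w" w] by (simp add: ip_minus_left inner_diff_left Re_ip_self)
  also have "\<dots> \<le> norm u * norm w - (norm w)\<^sup>2"
    using Re_ip_le[of u w] by simp
  finally have "norm w powr (p - 2) * inner (ip (u - w) w) 1
      \<le> norm w powr (p - 2) * (norm u * norm w - (norm w)\<^sup>2)"
    by (intro mult_left_mono) auto
  also have "\<dots> = norm u * norm w powr (p - 1) - norm w powr p"
    using e by (simp add: algebra_simps)
  also have "norm u * norm w powr (p - 1) \<le> norm u powr p / p + norm w powr p / q"
    using Youngs_inequality[OF p q(1,2), of "norm u" "norm w powr (p - 1)"] q(4)
    by (simp add: powr_powr)
  finally have "p * (norm w powr (p - 2) * inner (ip (u - w) w) 1)
      \<le> p * (norm u powr p / p + norm w powr p / q - norm w powr p)"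
    using p by (intro mult_left_mono) auto
  also have "\<dots> = norm u powr p + p / q * norm w powr p - p * norm w powr p"
    using p by (simp add: algebra_simps)
  finally show ?thesis unfolding q(3) by (simp add: algebra_simps)
qed

end

section \<open>The duality map of a Hilbert space\<close>

locale hilbert_duality = hilbert_space_over scale ip
  for scale :: "'f::{real_normed_field,euclidean_space} \<Rightarrow> 'k::banach \<Rightarrow> 'k" and ip +
  fixes \<nu> :: "'k \<Rightarrow> 'k \<Rightarrow> 'f"
  assumes iso: "isometric_dual_isomorphism scale \<nu>"
begin

lemma nu_add: "\<nu> (u + v) k = \<nu> u k + \<nu> v k"
  and nu_scale: "\<nu> (scale a u) k = a * \<nu> u k"
  and onorm_nu: "onorm (\<nu> u) = norm u"
  and nu_bij: "bij_betw \<nu> UNIV (dual_space scale)"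
  using iso by (auto simp: isometric_dual_isomorphism_def)

lemma nu_dual: "\<nu> u \<in> dual_space scale"
  using nu_bij by (auto simp: bij_betw_def)

lemma nu_bounded_linear: "bounded_linear (\<nu> u)"
  using nu_dual by (auto simp: dual_space_def bounded_operators_def)

lemma nu_scale_arg: "\<nu> u (scale a k) = a * \<nu> u k"
proof -
  interpret l: Vector_Spaces.linear scale "(*)" "\<nu> u"
    using nu_dual[of u] by (auto simp: dual_space_def bounded_operators_def)
  show ?thesis by (rule l.scale)
qed

lemma norm_nu_le: "norm (\<nu> v u) \<le> norm v * norm u"
  using onorm[OF nu_bounded_linear, of v u] by (simp add: onorm_nu)

lemma nu_bounded_bilinear: "bounded_bilinear \<nu>"
proof
  fix a a' b b' :: 'k and r :: real
  show "\<nu> (a + a') b = \<nu> a b + \<nu> a' b" by (rule nu_add)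
  show "\<nu> a (b + b') = \<nu> a b + \<nu> a b'"
    using nu_bounded_linear bounded_linear.linear linear_add by blast
  show "\<nu> (r *\<^sub>R a) b = r *\<^sub>R \<nu> a b"
    by (metis nu_scale scale_of_real scaleR_conv_of_real)
  show "\<nu> a (r *\<^sub>R b) = r *\<^sub>R \<nu> a b"
    by (metis nu_scale_arg scale_of_real scaleR_conv_of_real)
  show "\<exists>K. \<forall>a b. norm (\<nu> a b) \<le> norm a * norm b * K"
    using norm_nu_le by (intro exI[of _ 1]) auto
qed

sublocale nu: bounded_bilinear \<nu> by (rule nu_bounded_bilinear)

text \<open>
  The conjugate-linear isometry of \<open>K\<close> that translates between the inner product and \<open>\<nu>\<close>.
\<close>

definition J :: "'k \<Rightarrow> 'k" where
  "J u = inv \<nu> (\<lambda>v. ip v u)"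

lemma nu_J: "\<nu> (J u) v = ip v u"
proof -
  have "(\<lambda>v. ip v u) \<in> range \<nu>"
    using nu_bij ip_in_dual by (auto simp: bij_betw_def)
  then have "\<nu> (J u) = (\<lambda>v. ip v u)"
    unfolding J_def by (rule f_inv_into_f)
  then show ?thesis by simp
qed

lemma J_eqI: "J u = g" if "\<And>v. \<nu> g v = ip v u"
proof -
  have "\<nu> (J u) = \<nu> g" using that by (auto simp: nu_J)
  then show ?thesis using nu_bij by (auto simp: bij_betw_def dest: injD)
qed

lemma norm_J: "norm (J u) = norm u"
proof -
  have "\<nu> (J u) = (\<lambda>v. ip v u)" by (rule ext) (rule nu_J)
  then show ?thesis by (metis onorm_nu onorm_ip)
qed

lemma J_bounded_linear: "bounded_linear J"
proof (rule bounded_linear_intro[where K = 1])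
  show "J (u + v) = J u + J v" for u v
    by (rule J_eqI) (simp add: nu_add nu_J ip_add_right)
  show "J (r *\<^sub>R u) = r *\<^sub>R J u" for r u
    by (rule J_eqI) (simp add: nu.scaleR_left nu_J ip_scaleR_right scaleR_conv_of_real)
qed (simp add: norm_J)

sublocale J: bounded_linear J by (rule J_bounded_linear)

lemma almost_norming:
  assumes "norm g = 1" "0 < e" "e \<le> 1"
  shows "\<exists>u. norm u = 1 \<and> 1 - e < inner (\<nu> g u) 1"
proof -
  have "\<exists>v. (1 - e) * norm v < norm (\<nu> g v)"
  proof (rule ccontr)
    assume "\<not> ?thesis"
    then have "onorm (\<nu> g) \<le> 1 - e"
      using assms by (intro onorm_bound) (auto simp: not_less)
    then show False using assms by (simp add: onorm_nu)
  qed
  then obtain v where v: "(1 - e) * norm v < norm (\<nu> g v)" by blast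
  moreover have "0 \<le> (1 - e) * norm v" using assms by simp
  ultimately have nz: "\<nu> g v \<noteq> 0" and v0: "v \<noteq> 0" by (auto simp: nu.zero_right)
  define b where "b = of_real (norm (\<nu> g v) / norm v) / \<nu> g v"
  have "norm (scale b v) = 1" using v0 nz by (simp add: norm_scale b_def norm_divide norm_mult)
  moreover have "\<nu> g (scale b v) = of_real (norm (\<nu> g v) / norm v)"
    unfolding nu_scale_arg b_def using nz by simp
  moreover have "1 - e < norm (\<nu> g v) / norm v" using v v0 by (simp add: field_simps)
  ultimately show ?thesis by (intro exI[of _ "scale b v"]) (simp add: inner_of_real_one del: of_real_divide)
qed

lemma Re_le_norm: "inner (a::'f) 1 \<le> norm a"
  using norm_cauchy_schwarz[of a 1] by simp

text \<open>
  Almost norming unit vectors \<open>s\<^sub>m\<close>, \<open>s\<^sub>n\<close> have \<open>|s\<^sub>m + s\<^sub>n|\<close> close to 2, so by the parallelogram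
  law they are close to each other, and a sequence of them converges.
\<close>

lemma norm_attained:
  assumes g: "norm g = 1"
  shows "\<exists>u. norm u = 1 \<and> inner (\<nu> g u) 1 = 1"
proof -
  define s where "s n = (SOME u. norm u = 1 \<and> 1 - inverse (real (Suc n)) < inner (\<nu> g u) 1)" for n
  have s: "norm (s n) = 1" "1 - inverse (real (Suc n)) < inner (\<nu> g (s n)) 1" for n
    unfolding s_def using someI_ex[OF almost_norming[OF g, of "inverse (real (Suc n))"]]
    by (auto simp: inverse_le_1_iff)
  have close: "(norm (s m - s n))\<^sup>2 \<le> 8 * e"
    if "inverse (real (Suc m)) \<le> e" "inverse (real (Suc n)) \<le> e" "e \<le> 1" for m n e
  proof -
    have "2 - 2 * e \<le> inner (\<nu> g (s m + s n)) 1"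
      using s(2)[of m] s(2)[of n] that by (simp add: nu.add_right inner_add_left)
    also have "\<dots> \<le> norm (s m + s n)"
      using Re_le_norm[of "\<nu> g (s m + s n)"] norm_nu_le[of g "s m + s n"] g by simp
    finally have "(2 - 2 * e)\<^sup>2 \<le> (norm (s m + s n))\<^sup>2" using that by (intro power_mono) auto
    moreover have "(2 - 2 * e)\<^sup>2 = 4 - 8 * e + 4 * e\<^sup>2" by (simp add: power2_eq_square algebra_simps)
    moreover have "0 \<le> e\<^sup>2" by simp
    moreover have "(norm (s m + s n))\<^sup>2 + (norm (s m - s n))\<^sup>2 = 4"
      using parallelogram[of "s m" "s n"] s(1) by simp
    ultimately show ?thesis by linarith
  qed
  have "Cauchy s"
  proof (rule CauchyI)
    fix e :: real assume e: "0 < e"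
    define d where "d = min 1 (e\<^sup>2 / 16)"
    have d: "0 < d" "d \<le> 1" "8 * d < e\<^sup>2" using e by (auto simp: d_def min_def)
    obtain N where N: "inverse (real (Suc N)) < d" using reals_Archimedean[OF d(1)] by auto
    have "norm (s m - s n) < e" if "N \<le> m" "N \<le> n" for m n
    proof -
      have "inverse (real (Suc m)) \<le> d" "inverse (real (Suc n)) \<le> d"
        using N that by (smt (verit) le_imp_inverse_le of_nat_0_less_iff of_nat_mono Suc_le_mono zero_less_Suc)+
      from close[OF this d(2)] d(3) have "(norm (s m - s n))\<^sup>2 < e\<^sup>2" by simp
      then show ?thesis using e by (simp add: power2_less_imp_less)
    qed
    then show "\<exists>N. \<forall>m\<ge>N. \<forall>n\<ge>N. norm (s m - s n) < e" by blast
  qed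
  then obtain u where u: "s \<longlonglongrightarrow> u" using Cauchy_convergent convergent_def by blast
  have "(\<lambda>n. norm (s n)) \<longlonglongrightarrow> norm u" by (intro tendsto_norm u)
  then have nu1: "norm u = 1" using s(1) by (simp add: LIMSEQ_const_iff)
  have "(\<lambda>n. 1 - inverse (real (Suc n))) \<longlonglongrightarrow> 1 - 0"
    by (intro tendsto_intros LIMSEQ_inverse_real_of_nat)
  moreover have "(\<lambda>n. inner (\<nu> g (s n)) 1) \<longlonglongrightarrow> inner (\<nu> g u) 1"
    by (intro tendsto_intros nu.tendsto u)
  ultimately have "1 - 0 \<le> inner (\<nu> g u) 1"
    by (rule LIMSEQ_le) (use s(2) less_imp_le in blast)
  moreover have "inner (\<nu> g u) 1 \<le> 1"
    using Re_le_norm[of "\<nu> g u"] norm_nu_le[of g u] g nu1 by simp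
  ultimately show ?thesis using nu1 by auto
qed

text \<open>
  The Riesz representation theorem for \<open>K\<close>. If \<open>u\<close> is a norming unit vector of \<open>\<nu> h\<close>, where
  \<open>|h| = 1\<close>, then \<open>\<nu> (J u) + \<nu> h\<close> has the value 2 at \<open>u\<close>. As \<open>\<nu>\<close> is isometric,
  \<open>|J u + h| = 2\<close>, and the parallelogram law forces \<open>J u = h\<close>.
\<close>

lemma J_surj: "\<exists>u. J u = g"
proof (cases "g = 0")
  case True
  then show ?thesis using J.zero by (intro exI[of _ 0]) simp
next
  case False
  define h where "h = (1 / norm g) *\<^sub>R g"
  have h: "norm h = 1" using False by (simp add: h_def)
  then obtain u where u: "norm u = 1" "inner (\<nu> h u) 1 = 1" using norm_attained by blast
  have "2 = inner (\<nu> (J u + h) u) 1"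
    using u Re_ip_self[of u] by (simp add: nu.add_left nu_J inner_add_left)
  also have "\<dots> \<le> norm (J u + h)"
    using Re_le_norm[of "\<nu> (J u + h) u"] norm_nu_le[of "J u + h" u] u by simp
  finally have "2\<^sup>2 \<le> (norm (J u + h))\<^sup>2" by (intro power_mono) auto
  moreover have "(norm (J u + h))\<^sup>2 + (norm (J u - h))\<^sup>2 = 2\<^sup>2"
    using parallelogram[of "J u" h] u h by (simp add: norm_J)
  ultimately have "(norm (J u - h))\<^sup>2 \<le> 0" by linarith
  then have "J u = h" by simp
  then have "J (norm g *\<^sub>R u) = g" using False by (simp add: J.scaleR h_def)
  then show ?thesis by blast
qed

definition J_inv :: "'k \<Rightarrow> 'k" where "J_inv = inv J"

lemma J_J_inv: "J (J_inv g) = g"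
  unfolding J_inv_def using J_surj by (metis surj_f_inv_f surj_def)

lemma norm_J_inv: "norm (J_inv g) = norm g"
  by (metis J_J_inv norm_J)

lemma J_inv_continuous: "continuous_on UNIV J_inv"
proof -
  have "dist (J_inv x) (J_inv y) = dist x y" for x y
    by (metis J.diff J_J_inv dist_norm norm_J)
  then show ?thesis by (auto simp: continuous_on_iff)
qed

lemma nu_J_inv_self: "\<nu> g (J_inv g) = of_real ((norm g)\<^sup>2)"
  using nu_J[of "J_inv g" "J_inv g"] by (simp add: J_J_inv ip_self norm_J_inv)

end

section \<open>Bochner measurable functions\<close>

lemma borel_measurable_completion_AE_cong:
  assumes g: "g \<in> borel_measurable (completion M)" and eq: "AE \<omega> in M. f \<omega> = g \<omega>"
  shows "f \<in> borel_measurable (completion M)"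
proof (rule measurableI)
  fix A :: "'b set" assume A: "A \<in> sets borel"
  show "f -` A \<inter> space (completion M) \<in> sets (completion M)"
  proof (rule completion.in_sets_AE)
    show "AE \<omega> in completion M. (\<omega> \<in> g -` A \<inter> space (completion M)) = (\<omega> \<in> f -` A \<inter> space (completion M))"
      using AE_completion[OF eq] by eventually_elim auto
    show "g -` A \<inter> space (completion M) \<in> sets (completion M)"
      using g A by (rule measurable_sets)
  qed auto
qed simp

text \<open>
  Off a null set the function is a pointwise limit of simple functions, hence Borel measurable;
  the completion makes its values on the null set irrelevant.
\<close>

lemma bochner_measurable_imp_borel:
  fixes f :: "'w \<Rightarrow> 'b::real_normed_vector"
  assumes "bochner_measurable M f"
  shows "f \<in> borel_measurable (completion M)"
proof -
  obtain s where s: "\<And>n::nat. simple_function M (s n)"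
    and lim: "AE \<omega> in M. (\<lambda>n. norm (s n \<omega> - f \<omega>)) \<longlonglongrightarrow> 0"
    using assms by (auto simp: bochner_measurable_def)
  from lim obtain N where N: "{\<omega>\<in>space M. \<not> (\<lambda>n. norm (s n \<omega> - f \<omega>)) \<longlonglongrightarrow> 0} \<subseteq> N" "N \<in> null_sets M"
    by (auto elim!: AE_E intro: null_setsI)
  define g where "g \<omega> = (if \<omega> \<in> N then 0 else f \<omega>)" for \<omega>
  have "g \<in> borel_measurable M"
  proof (rule borel_measurable_LIMSEQ_metric)
    show "(\<lambda>\<omega>. if \<omega> \<in> N then 0 else s n \<omega>) \<in> borel_measurable M" for n
      using N(2) borel_measurable_simple_function[OF s[of n]]
      by (intro measurable_If_set) auto
    show "(\<lambda>n. if \<omega> \<in> N then 0 else s n \<omega>) \<longlonglongrightarrow> g \<omega>" if "\<omega> \<in> space M" for \<omega>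
      using N(1) that by (auto simp: g_def tendsto_norm_zero_iff LIM_zero_iff)
  qed
  moreover have "AE \<omega> in M. f \<omega> = g \<omega>"
    using AE_not_in[OF N(2)] by eventually_elim (simp add: g_def)
  ultimately show ?thesis
    using measurable_completion borel_measurable_completion_AE_cong by blast
qed

lemma bochner_measurable_compose:
  fixes \<phi> :: "'a::real_normed_vector \<Rightarrow> 'b::real_normed_vector"
  assumes F: "bochner_measurable M F" and \<phi>: "continuous_on UNIV \<phi>"
  shows "bochner_measurable M (\<lambda>\<omega>. \<phi> (F \<omega>))"
proof -
  obtain s where s: "\<And>n::nat. simple_function M (s n)"
    and lim: "AE \<omega> in M. (\<lambda>n. norm (s n \<omega> - F \<omega>)) \<longlonglongrightarrow> 0"
    using F by (auto simp: bochner_measurable_def)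
  have "simple_function M (\<lambda>\<omega>. \<phi> (s n \<omega>))" for n
    using s by (rule simple_function_compose1)
  moreover have "AE \<omega> in M. (\<lambda>n. norm (\<phi> (s n \<omega>) - \<phi> (F \<omega>))) \<longlonglongrightarrow> 0"
    using lim
  proof eventually_elim
    case (elim \<omega>)
    then have "(\<lambda>n. s n \<omega>) \<longlonglongrightarrow> F \<omega>" by (simp add: tendsto_norm_zero_iff LIM_zero_iff)
    then have "(\<lambda>n. \<phi> (s n \<omega>)) \<longlonglongrightarrow> \<phi> (F \<omega>)"
      by (intro continuous_on_tendsto_compose[OF \<phi>]) auto
    then show ?case by (simp add: tendsto_norm_zero_iff LIM_zero_iff)
  qed
  ultimately show ?thesis unfolding bochner_measurable_def by (intro exI[of _ "\<lambda>n \<omega>. \<phi> (s n \<omega>)"]) auto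
qed

lemma bochner_measurable_Pair:
  assumes F: "bochner_measurable M F" and G: "bochner_measurable M G"
  shows "bochner_measurable M (\<lambda>\<omega>. (F \<omega>, G \<omega>))"
proof -
  obtain s where s: "\<And>n::nat. simple_function M (s n)"
    and lims: "AE \<omega> in M. (\<lambda>n. norm (s n \<omega> - F \<omega>)) \<longlonglongrightarrow> 0"
    using F by (auto simp: bochner_measurable_def)
  obtain t where t: "\<And>n::nat. simple_function M (t n)"
    and limt: "AE \<omega> in M. (\<lambda>n. norm (t n \<omega> - G \<omega>)) \<longlonglongrightarrow> 0"
    using G by (auto simp: bochner_measurable_def)
  have "AE \<omega> in M. (\<lambda>n. norm ((s n \<omega>, t n \<omega>) - (F \<omega>, G \<omega>))) \<longlonglongrightarrow> 0"
    using lims limt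
  proof eventually_elim
    case (elim \<omega>)
    then have "(\<lambda>n. (s n \<omega>, t n \<omega>)) \<longlonglongrightarrow> (F \<omega>, G \<omega>)"
      by (intro tendsto_Pair) (auto simp: tendsto_norm_zero_iff LIM_zero_iff)
    then show ?case by (subst tendsto_norm_zero_iff) (rule LIM_zero)
  qed
  then show ?thesis
    unfolding bochner_measurable_def using s t by (intro exI[of _ "\<lambda>n \<omega>. (s n \<omega>, t n \<omega>)"]) auto
qed

lemma bochner_measurable_compose2:
  fixes \<phi> :: "'a::real_normed_vector \<Rightarrow> 'b::real_normed_vector \<Rightarrow> 'c::real_normed_vector"
  assumes "bochner_measurable M F" "bochner_measurable M G"
    and "continuous_on UNIV (\<lambda>x. \<phi> (fst x) (snd x))"
  shows "bochner_measurable M (\<lambda>\<omega>. \<phi> (F \<omega>) (G \<omega>))"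
  using bochner_measurable_compose[OF bochner_measurable_Pair[OF assms(1,2)] assms(3)] by simp

lemma bochner_measurable_add:
  "bochner_measurable M F \<Longrightarrow> bochner_measurable M G \<Longrightarrow> bochner_measurable M (\<lambda>\<omega>. F \<omega> + G \<omega>)"
  by (rule bochner_measurable_compose2) (auto intro!: continuous_intros)

lemma bochner_measurable_scaleR:
  "bochner_measurable M F \<Longrightarrow> bochner_measurable M (\<lambda>\<omega>. c *\<^sub>R F \<omega>)"
  by (rule bochner_measurable_compose) (auto intro!: continuous_intros)

lemma bochner_measurable_norm_powr:
  assumes "bochner_measurable M F"
  shows "(\<lambda>\<omega>. norm (F \<omega>) powr r) \<in> borel_measurable (completion M)"
proof -
  have "bochner_measurable M (\<lambda>\<omega>. norm (F \<omega>))"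
    using assms by (rule bochner_measurable_compose) (auto intro!: continuous_intros)
  from bochner_measurable_imp_borel[OF this] show ?thesis by measurable
qed

section \<open>Functions with integrable powers\<close>

lemma Lfun_iff:
  "F \<in> Lfun r M \<longleftrightarrow> bochner_measurable M F \<and> integrable (completion M) (\<lambda>\<omega>. norm (F \<omega>) powr r)"
  unfolding Lfun_def integrable_iff_bounded using bochner_measurable_norm_powr by auto

lemma LfunD:
  assumes "F \<in> Lfun r M"
  shows "bochner_measurable M F" "integrable (completion M) (\<lambda>\<omega>. norm (F \<omega>) powr r)"
  using assms by (auto simp: Lfun_iff)

lemma LfunI_bound:
  assumes "bochner_measurable M F" "integrable (completion M) h" "\<And>\<omega>. norm (F \<omega>) powr r \<le> h \<omega>"
  shows "F \<in> Lfun r M"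
  unfolding Lfun_iff
  using assms(1) order_trans[OF assms(3) abs_ge_self]
  by (auto intro!: Bochner_Integration.integrable_bound[OF assms(2)] bochner_measurable_norm_powr)

lemma Lnorm_eq_integral:
  assumes "F \<in> Lfun r M"
  shows "Lnorm r M F = (\<integral>\<omega>. norm (F \<omega>) powr r \<partial>completion M) powr (1 / r)"
  unfolding Lnorm_def using LfunD[OF assms] by (subst integral_eq_nn_integral) auto

lemma Lnorm_nonneg: "0 \<le> Lnorm r M F"
  by (simp add: Lnorm_def)

lemma Lnorm_powr:
  assumes "F \<in> Lfun r M" "0 < r"
  shows "Lnorm r M F powr r = (\<integral>\<omega>. norm (F \<omega>) powr r \<partial>completion M)"
  unfolding Lnorm_eq_integral[OF assms(1)] using assms(2) by (simp add: powr_powr)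

lemma Lnorm_AE_cong:
  assumes "AE \<omega> in M. F \<omega> = G \<omega>"
  shows "Lnorm r M F = Lnorm r M G"
proof -
  have "(\<integral>\<^sup>+ \<omega>. ennreal (norm (F \<omega>) powr r) \<partial>completion M) = (\<integral>\<^sup>+ \<omega>. ennreal (norm (G \<omega>) powr r) \<partial>completion M)"
    using AE_completion[OF assms] by (intro nn_integral_cong_AE) auto
  then show ?thesis by (simp add: Lnorm_def)
qed

lemma Lfun_AE_zero:
  assumes F: "F \<in> Lfun r M" and z: "(\<integral>\<omega>. norm (F \<omega>) powr r \<partial>completion M) = 0"
  shows "AE \<omega> in M. F \<omega> = 0"
proof -
  have "AE \<omega> in completion M. norm (F \<omega>) powr r = 0"
    using integral_nonneg_eq_0_iff_AE[OF LfunD(2)[OF F]] z by simp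
  then show ?thesis by (simp add: AE_completion_iff)
qed

lemma Lfun_scaleR:
  assumes "F \<in> Lfun r M"
  shows "(\<lambda>\<omega>. c *\<^sub>R F \<omega>) \<in> Lfun r M"
  using assms by (auto simp: Lfun_iff powr_mult bochner_measurable_scaleR)

text \<open>
  A crude bound, with a constant that is good enough for integrability.
\<close>

lemma norm_add_powr_le:
  assumes "0 < r"
  shows "norm (u + v) powr r \<le> 2 powr r * (norm u powr r + norm v powr r)"
proof -
  have "norm (u + v) \<le> 2 * max (norm u) (norm v)"
    using norm_triangle_ineq[of u v] by linarith
  then have "norm (u + v) powr r \<le> (2 * max (norm u) (norm v)) powr r"
    using assms by (intro powr_mono2) auto
  also have "\<dots> = 2 powr r * max (norm u) (norm v) powr r" by (simp add: powr_mult)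
  also have "\<dots> \<le> 2 powr r * (norm u powr r + norm v powr r)"
    by (intro mult_left_mono) (auto simp: max_def)
  finally show ?thesis .
qed

lemma Lfun_add:
  assumes "F \<in> Lfun r M" "G \<in> Lfun r M" "0 < r"
  shows "(\<lambda>\<omega>. F \<omega> + G \<omega>) \<in> Lfun r M"
proof (rule LfunI_bound)
  show "bochner_measurable M (\<lambda>\<omega>. F \<omega> + G \<omega>)"
    using assms by (auto simp: Lfun_iff intro: bochner_measurable_add)
  show "integrable (completion M) (\<lambda>\<omega>. 2 powr r * (norm (F \<omega>) powr r + norm (G \<omega>) powr r))"
    using assms by (auto simp: Lfun_iff)
qed (rule norm_add_powr_le[OF assms(3)])

lemma Lfun_diff:
  assumes "F \<in> Lfun r M" "G \<in> Lfun r M" "0 < r"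
  shows "(\<lambda>\<omega>. F \<omega> - G \<omega>) \<in> Lfun r M"
  using Lfun_add[OF assms(1) Lfun_scaleR[OF assms(2), of "-1"] assms(3)] by simp

lemma zero_in_Lfun: "(\<lambda>\<omega>. 0) \<in> Lfun r M"
proof -
  have "bochner_measurable M (\<lambda>\<omega>. 0 :: 'b)"
    unfolding bochner_measurable_def by (intro exI[of _ "\<lambda>n \<omega>. 0"]) simp
  then show ?thesis by (simp add: Lfun_iff)
qed

section \<open>Hoelder's inequality\<close>

lemma conjugate_exponent:
  fixes p q :: real
  assumes "1 < p" "1 / p + 1 / q = 1"
  shows "1 < q" "(p - 1) * q = p" "(q - 1) * p = q"
proof -
  have "1 / q = (p - 1) / p" using assms by (simp add: field_simps)
  then have q: "q = p / (p - 1)" by (metis inverse_eq_divide inverse_divide inverse_inverse_eq)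
  show "1 < q" "(p - 1) * q = p" "(q - 1) * p = q" using assms(1) unfolding q by (auto simp: field_simps)
qed

lemma integrable_norm_mult:
  fixes p q :: real
  assumes pq: "1 < p" "1 / p + 1 / q = 1" and F: "F \<in> Lfun p M" and G: "G \<in> Lfun q M"
  shows "integrable (completion M) (\<lambda>\<omega>. norm (F \<omega>) * norm (G \<omega>))"
proof (rule Bochner_Integration.integrable_bound)
  show "integrable (completion M) (\<lambda>\<omega>. norm (F \<omega>) powr p / p + norm (G \<omega>) powr q / q)"
    using LfunD[OF F] LfunD[OF G] by auto
  have "bochner_measurable M (\<lambda>\<omega>. norm (F \<omega>) * norm (G \<omega>))"
    using LfunD(1)[OF F] LfunD(1)[OF G] by (rule bochner_measurable_compose2) (auto intro!: continuous_intros)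
  then show "(\<lambda>\<omega>. norm (F \<omega>) * norm (G \<omega>)) \<in> borel_measurable (completion M)"
    by (rule bochner_measurable_imp_borel)
  show "AE \<omega> in completion M. norm (norm (F \<omega>) * norm (G \<omega>))
      \<le> norm (norm (F \<omega>) powr p / p + norm (G \<omega>) powr q / q)"
    using Youngs_inequality[OF pq(1) conjugate_exponent(1)[OF pq] pq(2) norm_ge_zero norm_ge_zero]
      pq conjugate_exponent(1)[OF pq]
    by (auto intro!: always_eventually order_trans[OF _ abs_ge_self])
qed

text \<open>
  Young's inequality for \<open>|F| / \<parallel>F\<parallel>\<close> and \<open>|G| / \<parallel>G\<parallel>\<close>, integrated.
\<close>

lemma Hoelder_inequality:
  fixes p q :: real
  assumes pq: "1 < p" "1 / p + 1 / q = 1" and F: "F \<in> Lfun p M" and G: "G \<in> Lfun q M"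
  shows "(\<integral>\<omega>. norm (F \<omega>) * norm (G \<omega>) \<partial>completion M) \<le> Lnorm p M F * Lnorm q M G"
proof -
  note q = conjugate_exponent(1)[OF pq]
  define a where "a = Lnorm p M F"
  define b where "b = Lnorm q M G"
  have ap: "a powr p = (\<integral>\<omega>. norm (F \<omega>) powr p \<partial>completion M)"
    and bq: "b powr q = (\<integral>\<omega>. norm (G \<omega>) powr q \<partial>completion M)"
    using F G pq q by (auto simp: a_def b_def Lnorm_powr)
  have ge: "0 \<le> a" "0 \<le> b" by (simp_all add: a_def b_def Lnorm_nonneg)
  show ?thesis
  proof (cases "a = 0 \<or> b = 0")
    case True
    then have "(AE \<omega> in M. F \<omega> = 0) \<or> (AE \<omega> in M. G \<omega> = 0)"
      using Lfun_AE_zero[OF F] Lfun_AE_zero[OF G] ap bq by auto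
    then have "AE \<omega> in completion M. norm (F \<omega>) * norm (G \<omega>) = 0"
      by (auto simp: AE_completion_iff elim: eventually_mono)
    then have "(\<integral>\<omega>. norm (F \<omega>) * norm (G \<omega>) \<partial>completion M) = 0" by (rule integral_eq_zero_AE)
    then show ?thesis by (simp add: Lnorm_nonneg)
  next
    case False
    then have pos: "0 < a" "0 < b" using ge by auto
    have "(\<integral>\<omega>. norm (F \<omega>) * norm (G \<omega>) \<partial>completion M)
      \<le> (\<integral>\<omega>. a * b * (norm (F \<omega>) powr p / a powr p / p + norm (G \<omega>) powr q / b powr q / q) \<partial>completion M)"
    proof (rule integral_mono[OF integrable_norm_mult[OF assms]])
      show "integrable (completion M)
          (\<lambda>\<omega>. a * b * (norm (F \<omega>) powr p / a powr p / p + norm (G \<omega>) powr q / b powr q / q))"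
        using LfunD[OF F] LfunD[OF G] by auto
      fix \<omega>
      have "norm (F \<omega>) / a * (norm (G \<omega>) / b) \<le> (norm (F \<omega>) / a) powr p / p + (norm (G \<omega>) / b) powr q / q"
        using Youngs_inequality[OF pq(1) q pq(2), of "norm (F \<omega>) / a" "norm (G \<omega>) / b"] pos by simp
      then have "a * b * (norm (F \<omega>) / a * (norm (G \<omega>) / b))
          \<le> a * b * ((norm (F \<omega>) / a) powr p / p + (norm (G \<omega>) / b) powr q / q)"
        using pos by (intro mult_left_mono) auto
      then show "norm (F \<omega>) * norm (G \<omega>)
          \<le> a * b * (norm (F \<omega>) powr p / a powr p / p + norm (G \<omega>) powr q / b powr q / q)"
        using pos by (simp add: powr_divide)
    qed
    also have "\<dots> = a * b * (a powr p / a powr p / p + b powr q / b powr q / q)"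
      unfolding ap bq using LfunD[OF F] LfunD[OF G] by (simp add: integral_add)
    also have "\<dots> = a * b" using pos pq(2) by simp
    finally show ?thesis by (simp add: a_def b_def)
  qed
qed

lemma integrable_bilinear:
  fixes p q :: real and \<beta> :: "'a::real_normed_vector \<Rightarrow> 'b::real_normed_vector
      \<Rightarrow> 'c::{banach,second_countable_topology}"
  assumes \<beta>: "bounded_bilinear \<beta>"
    and pq: "1 < p" "1 / p + 1 / q = 1" and F: "F \<in> Lfun p M" and G: "G \<in> Lfun q M"
  shows "integrable (completion M) (\<lambda>\<omega>. \<beta> (G \<omega>) (F \<omega>))"
proof -
  obtain K where K: "\<And>u v. norm (\<beta> u v) \<le> norm u * norm v * K"
    using bounded_bilinear.bounded[OF \<beta>] by auto
  show ?thesis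
  proof (rule Bochner_Integration.integrable_bound)
    show "integrable (completion M) (\<lambda>\<omega>. norm (F \<omega>) * norm (G \<omega>) * K)"
      using integrable_norm_mult[OF pq F G] by auto
    have "bochner_measurable M (\<lambda>\<omega>. \<beta> (G \<omega>) (F \<omega>))"
      using LfunD(1)[OF G] LfunD(1)[OF F]
      by (rule bochner_measurable_compose2) (intro bounded_bilinear.continuous_on[OF \<beta>] continuous_intros)
    then show "(\<lambda>\<omega>. \<beta> (G \<omega>) (F \<omega>)) \<in> borel_measurable (completion M)"
      by (rule bochner_measurable_imp_borel)
    show "AE \<omega> in completion M. norm (\<beta> (G \<omega>) (F \<omega>)) \<le> norm (norm (F \<omega>) * norm (G \<omega>) * K)"
      using K by (intro always_eventually allI order_trans[OF K]) (simp add: mult.commute[of "norm (F _)"])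
  qed
qed

section \<open>Classes of functions\<close>

definition Lclass :: "real \<Rightarrow> 'w measure \<Rightarrow> ('w \<Rightarrow> 'k::real_normed_vector) \<Rightarrow> ('w \<Rightarrow> 'k) set" where
  "Lclass r M F = ae_equal r M `` {F}"

lemma equiv_ae_equal: "equiv (Lfun r M) (ae_equal r M)"
proof (rule equivI)
  show "ae_equal r M \<subseteq> Lfun r M \<times> Lfun r M" by (auto simp: ae_equal_def)
  show "refl_on (Lfun r M) (ae_equal r M)" by (auto simp: refl_on_def ae_equal_def)
  show "sym (ae_equal r M)" by (auto simp: sym_def ae_equal_def elim: eventually_mono)
  show "trans (ae_equal r M)"
  proof (rule transI)
    fix F G K assume "(F, G) \<in> ae_equal r M" "(G, K) \<in> ae_equal r M"
    then have *: "F \<in> Lfun r M" "K \<in> Lfun r M" "AE \<omega> in M. F \<omega> = G \<omega>" "AE \<omega> in M. G \<omega> = K \<omega>"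
      by (auto simp: ae_equal_def)
    from *(3,4) have "AE \<omega> in M. F \<omega> = K \<omega>" by eventually_elim simp
    with * show "(F, K) \<in> ae_equal r M" by (simp add: ae_equal_def)
  qed
qed

lemma Lclass_in_Lspace: "F \<in> Lfun r M \<Longrightarrow> Lclass r M F \<in> Lspace r M"
  unfolding Lclass_def Lspace_def by (rule quotientI)

lemma Lclass_eq_iff:
  assumes "F \<in> Lfun r M" "G \<in> Lfun r M"
  shows "Lclass r M F = Lclass r M G \<longleftrightarrow> (AE \<omega> in M. F \<omega> = G \<omega>)"
  unfolding Lclass_def using eq_equiv_class_iff[OF equiv_ae_equal assms] assms
  by (simp add: ae_equal_def)

lemma rep_Lclass:
  assumes "F \<in> Lfun r M"
  shows "rep (Lclass r M F) \<in> Lfun r M" "AE \<omega> in M. rep (Lclass r M F) \<omega> = F \<omega>"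
proof -
  have "F \<in> Lclass r M F" unfolding Lclass_def using equiv_class_self[OF equiv_ae_equal assms] .
  then have "rep (Lclass r M F) \<in> Lclass r M F" unfolding rep_def by (rule someI[where P = "\<lambda>F. F \<in> _"])
  then show "rep (Lclass r M F) \<in> Lfun r M" "AE \<omega> in M. rep (Lclass r M F) \<omega> = F \<omega>"
    by (auto simp: Lclass_def ae_equal_def elim: eventually_mono)
qed

lemma LspaceE:
  assumes "\<F> \<in> Lspace r M"
  obtains F where "F \<in> Lfun r M" "\<F> = Lclass r M F"
  using assms unfolding Lspace_def Lclass_def by (auto elim: quotientE)

lemma Lnorm_rep_Lclass: "F \<in> Lfun r M \<Longrightarrow> Lnorm r M (rep (Lclass r M F)) = Lnorm r M F"
  by (intro Lnorm_AE_cong rep_Lclass)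

section \<open>The duality map on Bochner spaces\<close>

lemma powr_minus_two_mult:
  fixes x r :: real
  assumes "0 \<le> x"
  shows "x powr (r - 2) * x = x powr (r - 1)" "x powr (r - 2) * x\<^sup>2 = x powr r"
proof -
  have "x powr (r - 2) * x powr 1 = x powr (r - 1)" "x powr (r - 2) * x powr 2 = x powr r"
    unfolding powr_add[symmetric] by simp_all
  then show "x powr (r - 2) * x = x powr (r - 1)" "x powr (r - 2) * x\<^sup>2 = x powr r"
    using assms by (cases "x = 0"; simp)+
qed

text \<open>
  For \<open>r < 2\<close> the scalar factor is unbounded near 0, but the norm of the product is
  \<open>|u|\<^sup>r\<^sup>-\<^sup>1\<close>, which tends to 0.
\<close>

lemma continuous_duality_map:
  fixes j :: "'a::real_normed_vector \<Rightarrow> 'b::real_normed_vector"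
  assumes r: "1 < r" and j: "continuous_on UNIV j" and nj: "\<And>u. norm (j u) = norm u"
  shows "continuous_on UNIV (\<lambda>u. norm u powr (r - 2) *\<^sub>R j u)"
  unfolding continuous_on_eq_continuous_at[OF open_UNIV]
proof
  fix u :: 'a
  have jc: "isCont j u" using j by (simp add: continuous_on_eq_continuous_at)
  show "isCont (\<lambda>u. norm u powr (r - 2) *\<^sub>R j u) u"
  proof (cases "u = 0")
    case False
    then show ?thesis using jc by (intro continuous_intros) auto
  next
    case True
    have "continuous_on UNIV (\<lambda>u::'a. norm u powr (r - 1))"
      using r by (intro continuous_on_powr' continuous_intros) auto
    then have "isCont (\<lambda>u::'a. norm u powr (r - 1)) 0" by (simp add: continuous_on_eq_continuous_at)
    then have "(\<lambda>u::'a. norm u powr (r - 1)) \<midarrow>0\<rightarrow> 0" by (simp add: isCont_def)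
    then have "(\<lambda>u. norm u powr (r - 2) *\<^sub>R j u) \<midarrow>0\<rightarrow> 0"
      by (subst tendsto_norm_zero_iff[symmetric]) (simp add: nj powr_minus_two_mult)
    then show ?thesis using True by (simp add: isCont_def)
  qed
qed

lemma duality_map_norm_powr:
  fixes p q :: real
  assumes pq: "1 < p" "1 / p + 1 / q = 1" and nj: "norm (j u) = norm u"
  shows "norm (norm u powr (p - 2) *\<^sub>R j u) powr q = norm u powr p"
proof -
  have "norm (norm u powr (p - 2) *\<^sub>R j u) = norm u powr (p - 1)"
    by (simp add: nj powr_minus_two_mult)
  then show ?thesis using conjugate_exponent(2)[OF pq] by (simp add: powr_powr)
qed

lemma duality_map_Lfun:
  fixes p q :: real and j :: "'a::real_normed_vector \<Rightarrow> 'b::real_normed_vector"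
  assumes pq: "1 < p" "1 / p + 1 / q = 1" and F: "F \<in> Lfun p M"
    and j: "continuous_on UNIV j" and nj: "\<And>u. norm (j u) = norm u"
  shows "(\<lambda>\<omega>. norm (F \<omega>) powr (p - 2) *\<^sub>R j (F \<omega>)) \<in> Lfun q M"
  using LfunD[OF F] bochner_measurable_compose[OF _ continuous_duality_map[OF pq(1) j nj]]
  by (simp add: Lfun_iff duality_map_norm_powr[OF pq] nj del: norm_scaleR)

section \<open>Analysis and synthesis for a Bochner pg-frame\<close>

locale pg_frame = X: normed_space_over scX + hilbert_duality scK ip \<nu>
  for scX :: "'f::{real_normed_field,euclidean_space} \<Rightarrow> 'x::banach \<Rightarrow> 'x"
    and scK :: "'f \<Rightarrow> 'k::banach \<Rightarrow> 'k" and ip and \<nu> +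
  fixes M :: "'w measure" and H :: "'w \<Rightarrow> 'k set" and \<Lambda> :: "'w \<Rightarrow> 'x \<Rightarrow> 'k" and p q :: real
  assumes p: "1 < p" and pq: "1 / p + 1 / q = 1"
    and frame: "bochner_pg_frame p M scX scK H \<Lambda>"
begin

lemma q: "1 < q" and qp: "1 / q + 1 / p = 1"
  using conjugate_exponent[OF p pq] pq by auto

lemma Lam_Lfun: "(\<lambda>\<omega>. \<Lambda> \<omega> x) \<in> Lfun p M"
  using frame by (auto simp: bochner_pg_frame_def)

lemma Lam_operator: "\<omega> \<in> space M \<Longrightarrow> \<Lambda> \<omega> \<in> bounded_operators scX scK"
  using frame by (auto simp: bochner_pg_frame_def operator_family_def)

lemma Lam_bounded_linear: "\<omega> \<in> space M \<Longrightarrow> bounded_linear (\<Lambda> \<omega>)"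
  using Lam_operator by (auto simp: bounded_operators_def)

lemma Lam_add: "\<omega> \<in> space M \<Longrightarrow> \<Lambda> \<omega> (x + y) = \<Lambda> \<omega> x + \<Lambda> \<omega> y"
  and Lam_diff: "\<omega> \<in> space M \<Longrightarrow> \<Lambda> \<omega> (x - y) = \<Lambda> \<omega> x - \<Lambda> \<omega> y"
  and Lam_scaleR: "\<omega> \<in> space M \<Longrightarrow> \<Lambda> \<omega> (r *\<^sub>R x) = r *\<^sub>R \<Lambda> \<omega> x"
  and Lam_zero: "\<omega> \<in> space M \<Longrightarrow> \<Lambda> \<omega> 0 = 0"
  using Lam_bounded_linear bounded_linear.linear linear_add linear_diff linear_cmul linear_0 by blast+

lemma Lam_scale:
  assumes "\<omega> \<in> space M"
  shows "\<Lambda> \<omega> (scX a x) = scK a (\<Lambda> \<omega> x)"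
proof -
  interpret l: Vector_Spaces.linear scX scK "\<Lambda> \<omega>"
    using Lam_operator[OF assms] by (auto simp: bounded_operators_def)
  show ?thesis by (rule l.scale)
qed

lemma frame_bounds:
  obtains A B where "0 < A" "0 < B" "\<And>x. A * norm x \<le> Lnorm p M (\<lambda>\<omega>. \<Lambda> \<omega> x)"
    "\<And>x. Lnorm p M (\<lambda>\<omega>. \<Lambda> \<omega> x) \<le> B * norm x"
  using frame by (auto simp: bochner_pg_frame_def)

text \<open>
  The pairing of individual functions; \<open>Lpairing_Lclass\<close> and \<open>synthesis_Lclass\<close> reduce the
  pairings of classes to it.
\<close>

definition pair :: "('w \<Rightarrow> 'k) \<Rightarrow> ('w \<Rightarrow> 'k) \<Rightarrow> 'f" where
  "pair F G = (\<integral>\<omega>. \<nu> (G \<omega>) (F \<omega>) \<partial>completion M)"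

lemma pair_integrable:
  assumes "F \<in> Lfun p M" "G \<in> Lfun q M"
  shows "integrable (completion M) (\<lambda>\<omega>. \<nu> (G \<omega>) (F \<omega>))"
  using integrable_bilinear[OF nu_bounded_bilinear p pq assms] .

lemma pair_AE_cong:
  assumes "F \<in> Lfun p M" "F' \<in> Lfun p M" "G \<in> Lfun q M" "G' \<in> Lfun q M"
    and "AE \<omega> in M. F \<omega> = F' \<omega>" "AE \<omega> in M. G \<omega> = G' \<omega>"
  shows "pair F G = pair F' G'"
  unfolding pair_def
proof (rule integral_cong_AE)
  have "AE \<omega> in M. \<nu> (G \<omega>) (F \<omega>) = \<nu> (G' \<omega>) (F' \<omega>)"
    using assms(5,6) by eventually_elim simp
  then show "AE \<omega> in completion M. \<nu> (G \<omega>) (F \<omega>) = \<nu> (G' \<omega>) (F' \<omega>)" by (rule AE_completion)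
qed (use pair_integrable assms in auto)

lemma pair_diff_left:
  assumes "F \<in> Lfun p M" "F' \<in> Lfun p M" "G \<in> Lfun q M"
  shows "pair (\<lambda>\<omega>. F \<omega> - F' \<omega>) G = pair F G - pair F' G"
  unfolding pair_def using pair_integrable[OF assms(1,3)] pair_integrable[OF assms(2,3)]
  by (simp add: nu.diff_right)

lemma pair_diff_right:
  assumes "F \<in> Lfun p M" "G \<in> Lfun q M" "G' \<in> Lfun q M"
  shows "pair F (\<lambda>\<omega>. G \<omega> - G' \<omega>) = pair F G - pair F G'"
  unfolding pair_def using pair_integrable[OF assms(1,2)] pair_integrable[OF assms(1,3)]
  by (simp add: nu.diff_left)

lemma norm_pair_le:
  assumes "F \<in> Lfun p M" "G \<in> Lfun q M"
  shows "norm (pair F G) \<le> Lnorm p M F * Lnorm q M G"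
proof -
  have "norm (pair F G) \<le> (\<integral>\<omega>. norm (\<nu> (G \<omega>) (F \<omega>)) \<partial>completion M)"
    unfolding pair_def by (rule integral_norm_bound)
  also have "\<dots> \<le> (\<integral>\<omega>. norm (F \<omega>) * norm (G \<omega>) \<partial>completion M)"
    using norm_nu_le[of "G _" "F _"]
    by (intro integral_mono integrable_norm pair_integrable[OF assms] integrable_norm_mult[OF p pq assms])
      (simp add: mult.commute)
  also have "\<dots> \<le> Lnorm p M F * Lnorm q M G" by (rule Hoelder_inequality[OF p pq assms])
  finally show ?thesis .
qed

text \<open>
  Up to the factor \<open>p\<close>, \<open>F \<mapsto> pair F (duality_map F\<^sub>0)\<close> is, in its real part, the derivative of
  the integral of \<open>|F|\<^sup>p\<close> at \<open>F\<^sub>0\<close>.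
\<close>

definition duality_map :: "('w \<Rightarrow> 'k) \<Rightarrow> 'w \<Rightarrow> 'k" where
  "duality_map F \<omega> = norm (F \<omega>) powr (p - 2) *\<^sub>R J (F \<omega>)"

lemma J_continuous: "continuous_on UNIV J"
  by (rule linear_continuous_on[OF J_bounded_linear])

lemma duality_map_in_Lfun: "F \<in> Lfun p M \<Longrightarrow> duality_map F \<in> Lfun q M"
  unfolding duality_map_def[abs_def] using duality_map_Lfun[OF p pq _ J_continuous norm_J] .

lemma nu_duality_map: "\<nu> (duality_map F \<omega>) v = norm (F \<omega>) powr (p - 2) *\<^sub>R ip v (F \<omega>)"
  by (simp add: duality_map_def nu.scaleR_left nu_J)

lemma pair_duality_map_self: "pair F (duality_map F) = (\<integral>\<omega>. norm (F \<omega>) powr p *\<^sub>R 1 \<partial>completion M)"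
  unfolding pair_def nu_duality_map ip_self
  by (simp add: of_real_def powr_minus_two_mult del: of_real_power)

text \<open>
  Tested against its own image under the duality map, \<open>F\<close> yields the integral of \<open>|F|\<^sup>p\<close>.
\<close>

lemma AE_zero_if_pair_zero:
  assumes F: "F \<in> Lfun p M" and z: "\<And>G. G \<in> Lfun q M \<Longrightarrow> pair F G = 0"
  shows "AE \<omega> in M. F \<omega> = 0"
proof -
  have "pair F (duality_map F) = 0" using z duality_map_in_Lfun[OF F] .
  then have "(\<integral>\<omega>. norm (F \<omega>) powr p \<partial>completion M) = 0"
    unfolding pair_duality_map_self using LfunD[OF F] by simp
  then show ?thesis using Lfun_AE_zero F by blast
qed

lemma synthesis_Lclass:
  assumes G: "G \<in> Lfun q M"
  shows "synthesis M \<nu> \<Lambda> (Lclass q M G) = (\<lambda>x. pair (\<lambda>\<omega>. \<Lambda> \<omega> x) G)"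
proof
  fix x
  show "synthesis M \<nu> \<Lambda> (Lclass q M G) x = pair (\<lambda>\<omega>. \<Lambda> \<omega> x) G"
    unfolding synthesis_def pair_def[symmetric]
    using rep_Lclass[OF G] G by (intro pair_AE_cong Lam_Lfun) auto
qed

lemma Lpairing_Lclass:
  assumes "F \<in> Lfun p M" "G \<in> Lfun q M"
  shows "Lpairing M \<nu> (Lclass p M F) (Lclass q M G) = pair F G"
  unfolding Lpairing_def pair_def[symmetric]
  using rep_Lclass assms by (intro pair_AE_cong) auto

text \<open>
  The description operator in the definition picks this class because \<open>L\<^sup>q\<close> separates the points
  of \<open>L\<^sup>p\<close>.
\<close>

lemma analysis_eq: "analysis p q M \<nu> \<Lambda> x = Lclass p M (\<lambda>\<omega>. \<Lambda> \<omega> x)"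
  unfolding analysis_def
proof (rule the_equality)
  show "Lclass p M (\<lambda>\<omega>. \<Lambda> \<omega> x) \<in> Lspace p M \<and>
      (\<forall>\<G>\<in>Lspace q M. Lpairing M \<nu> (Lclass p M (\<lambda>\<omega>. \<Lambda> \<omega> x)) \<G> = synthesis M \<nu> \<Lambda> \<G> x)"
    by (auto simp: Lclass_in_Lspace Lam_Lfun Lpairing_Lclass synthesis_Lclass elim!: LspaceE)
next
  fix \<F> assume *: "\<F> \<in> Lspace p M \<and> (\<forall>\<G>\<in>Lspace q M. Lpairing M \<nu> \<F> \<G> = synthesis M \<nu> \<Lambda> \<G> x)"
  then obtain F where F: "F \<in> Lfun p M" "\<F> = Lclass p M F" by (auto elim: LspaceE)
  have "pair (\<lambda>\<omega>. F \<omega> - \<Lambda> \<omega> x) G = 0" if G: "G \<in> Lfun q M" for G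
  proof -
    have "Lpairing M \<nu> \<F> (Lclass q M G) = synthesis M \<nu> \<Lambda> (Lclass q M G) x"
      using * Lclass_in_Lspace[OF G] by blast
    then show ?thesis
      using pair_diff_left[OF F(1) Lam_Lfun G, of x]
      by (simp add: F(2) Lpairing_Lclass[OF F(1) G] synthesis_Lclass[OF G])
  qed
  then have "AE \<omega> in M. F \<omega> - \<Lambda> \<omega> x = 0"
    using p by (intro AE_zero_if_pair_zero Lfun_diff F Lam_Lfun) auto
  then show "\<F> = Lclass p M (\<lambda>\<omega>. \<Lambda> \<omega> x)"
    using F by (simp add: Lclass_eq_iff Lam_Lfun)
qed

lemma pair_Lam_linear:
  assumes G: "G \<in> Lfun q M"
  shows "pair (\<lambda>\<omega>. \<Lambda> \<omega> (x + y)) G = pair (\<lambda>\<omega>. \<Lambda> \<omega> x) G + pair (\<lambda>\<omega>. \<Lambda> \<omega> y) G"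
    and "pair (\<lambda>\<omega>. \<Lambda> \<omega> (scX a x)) G = a * pair (\<lambda>\<omega>. \<Lambda> \<omega> x) G"
proof -
  note int = pair_integrable[OF Lam_Lfun G]
  have "pair (\<lambda>\<omega>. \<Lambda> \<omega> (x + y)) G = (\<integral>\<omega>. \<nu> (G \<omega>) (\<Lambda> \<omega> x) + \<nu> (G \<omega>) (\<Lambda> \<omega> y) \<partial>completion M)"
    unfolding pair_def by (rule Bochner_Integration.integral_cong) (auto simp: Lam_add nu.add_right)
  then show "pair (\<lambda>\<omega>. \<Lambda> \<omega> (x + y)) G = pair (\<lambda>\<omega>. \<Lambda> \<omega> x) G + pair (\<lambda>\<omega>. \<Lambda> \<omega> y) G"
    unfolding pair_def using int by simp
  have "pair (\<lambda>\<omega>. \<Lambda> \<omega> (scX a x)) G = (\<integral>\<omega>. a * \<nu> (G \<omega>) (\<Lambda> \<omega> x) \<partial>completion M)"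
    unfolding pair_def by (rule Bochner_Integration.integral_cong) (auto simp: Lam_scale nu_scale_arg)
  then show "pair (\<lambda>\<omega>. \<Lambda> \<omega> (scX a x)) G = a * pair (\<lambda>\<omega>. \<Lambda> \<omega> x) G"
    unfolding pair_def using int by simp
qed

lemma pair_Lam_scaleR:
  "G \<in> Lfun q M \<Longrightarrow> pair (\<lambda>\<omega>. \<Lambda> \<omega> (r *\<^sub>R x)) G = r *\<^sub>R pair (\<lambda>\<omega>. \<Lambda> \<omega> x) G"
  by (metis pair_Lam_linear(2) X.scale_of_real scaleR_conv_of_real)

lemma pair_Lam_bounded_linear:
  assumes G: "G \<in> Lfun q M"
  shows "bounded_linear (\<lambda>x. pair (\<lambda>\<omega>. \<Lambda> \<omega> x) G)"
proof -
  obtain A B where B: "\<And>x. Lnorm p M (\<lambda>\<omega>. \<Lambda> \<omega> x) \<le> B * norm x"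
    using frame_bounds by metis
  show ?thesis
  proof (rule bounded_linear_intro[where K = "B * Lnorm q M G"])
    show "norm (pair (\<lambda>\<omega>. \<Lambda> \<omega> x) G) \<le> norm x * (B * Lnorm q M G)" for x
      using norm_pair_le[OF Lam_Lfun G, of x] mult_right_mono[OF B Lnorm_nonneg, of x q M G]
      by (simp add: algebra_simps)
  qed (simp_all add: G pair_Lam_linear pair_Lam_scaleR)
qed

lemma pair_Lam_in_dual_space:
  assumes G: "G \<in> Lfun q M"
  shows "(\<lambda>x. pair (\<lambda>\<omega>. \<Lambda> \<omega> x) G) \<in> dual_space scX"
proof -
  have "Vector_Spaces.linear scX (*) (\<lambda>x. pair (\<lambda>\<omega>. \<Lambda> \<omega> x) G)"
    by unfold_locales (auto simp: algebra_simps pair_Lam_linear[OF G])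
  then show ?thesis using pair_Lam_bounded_linear[OF G] by (simp add: dual_space_def bounded_operators_def)
qed

section \<open>Best approximation by the range of the analysis operator\<close>

definition residual :: "('w \<Rightarrow> 'k) \<Rightarrow> 'x \<Rightarrow> 'w \<Rightarrow> 'k" where
  "residual F x \<omega> = F \<omega> - \<Lambda> \<omega> x"

text \<open>
  \<open>energy F x\<close> is the \<open>p\<close>-th power of the distance from \<open>F\<close> to \<open>U x\<close>.
\<close>

definition energy :: "('w \<Rightarrow> 'k) \<Rightarrow> 'x \<Rightarrow> real" where
  "energy F x = (\<integral>\<omega>. norm (residual F x \<omega>) powr p \<partial>completion M)"

lemma residual_Lfun: "F \<in> Lfun p M \<Longrightarrow> residual F x \<in> Lfun p M"
  unfolding residual_def[abs_def] using p by (intro Lfun_diff Lam_Lfun) auto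

lemma energy_nonneg: "0 \<le> energy F x"
  unfolding energy_def by (rule integral_nonneg_AE) auto

text \<open>
  The pointwise tangent inequality at \<open>residual F x\<close>, integrated. It serves twice: since the linear
  term is a bounded functional of \<open>x - y\<close>, it gives the lower semicontinuity of the energy, and it
  gives the first variation at a minimizer.
\<close>

lemma energy_subgradient:
  assumes F: "F \<in> Lfun p M"
  shows "energy F x + p * inner (pair (\<lambda>\<omega>. \<Lambda> \<omega> (x - y)) (duality_map (residual F x))) 1 \<le> energy F y"
proof -
  let ?D = "duality_map (residual F x)"
  note int = pair_integrable[OF Lam_Lfun duality_map_in_Lfun[OF residual_Lfun[OF F]]]
  have int': "integrable (completion M) (\<lambda>\<omega>. inner (\<nu> (?D \<omega>) (\<Lambda> \<omega> (x - y))) 1)"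
    using int by (rule integrable_inner_left)
  have eq: "inner (pair (\<lambda>\<omega>. \<Lambda> \<omega> (x - y)) ?D) 1 = (\<integral>\<omega>. inner (\<nu> (?D \<omega>) (\<Lambda> \<omega> (x - y))) 1 \<partial>completion M)"
    unfolding pair_def using int by simp
  have "energy F x + p * inner (pair (\<lambda>\<omega>. \<Lambda> \<omega> (x - y)) ?D) 1
    = (\<integral>\<omega>. norm (residual F x \<omega>) powr p + p * inner (\<nu> (?D \<omega>) (\<Lambda> \<omega> (x - y))) 1 \<partial>completion M)"
    unfolding eq energy_def using int' LfunD(2)[OF residual_Lfun[OF F]] by simp
  also have "\<dots> \<le> energy F y"
    unfolding energy_def
  proof (rule integral_mono)
    fix \<omega> assume "\<omega> \<in> space (completion M)"
    then have "\<Lambda> \<omega> (x - y) = residual F y \<omega> - residual F x \<omega>" by (simp add: Lam_diff residual_def)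
    then show "norm (residual F x \<omega>) powr p + p * inner (\<nu> (?D \<omega>) (\<Lambda> \<omega> (x - y))) 1 \<le> norm (residual F y \<omega>) powr p"
      using powr_subgradient[OF p, of "residual F x \<omega>" "residual F y \<omega>"] by (simp add: nu_duality_map)
  qed (use int' LfunD(2)[OF residual_Lfun[OF F]] in auto)
  finally show ?thesis .
qed

lemma energy_minimizing_Cauchy:
  assumes F: "F \<in> Lfun p M" and lower: "\<And>y. d \<le> energy F y"
    and s: "\<And>n. energy F (s n) < d + inverse (real (Suc n))"
  shows "Cauchy s"
proof (rule CauchyI)
  fix e :: real assume e: "0 < e"
  obtain A where A: "0 < A" "\<And>x. A * norm x \<le> Lnorm p M (\<lambda>\<omega>. \<Lambda> \<omega> x)"
    using frame_bounds by metis
  \<comment> \<open>The target for the integral of \<open>|U (s m - s n)|\<^sup>p\<close>, which is at least \<open>(A \<parallel>s m - s n\<parallel>)\<^sup>p\<close>.\<close>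
  define \<eta> where "\<eta> = (A * e) powr p"
  have \<eta>: "0 < \<eta>" using A e by (simp add: \<eta>_def)
  \<comment> \<open>Both energies will be at most \<open>\<bar>d\<bar> + 1\<close>; the factor \<open>\<kappa>\<close> makes their share at most \<open>\<eta> / 2\<close>.\<close>
  define \<kappa> where "\<kappa> = \<eta> / (4 * (\<bar>d\<bar> + 1))"
  have \<kappa>: "0 < \<kappa>" using \<eta> by (simp add: \<kappa>_def add_nonneg_pos)
  obtain C where C: "0 < C" and ineq:
    "\<And>u v :: 'k. norm (u - v) powr p \<le> \<kappa> * (norm u powr p + norm v powr p)
       + C * ((norm u powr p + norm v powr p) / 2 - norm ((1/2) *\<^sub>R (u + v)) powr p)"
    using norm_uniform_convexity[OF p, of \<kappa>] \<kappa> by metis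
  \<comment> \<open>The convexity gap is below \<open>1 / (N + 1)\<close>, as the midpoint has energy at least \<open>d\<close>.\<close>
  obtain N where N: "inverse (real (Suc N)) < \<eta> / (2 * C)"
    using reals_Archimedean[of "\<eta> / (2 * C)"] \<eta> C by auto
  have "norm (s m - s n) < e" if mn: "N \<le> m" "N \<le> n" for m n
  proof -
    let ?h = "inverse (real (Suc N))"
    have small: "energy F (s k) < d + ?h" if "N \<le> k" for k
    proof -
      have "inverse (real (Suc k)) \<le> ?h" using that by (intro le_imp_inverse_le) auto
      then show ?thesis using s[of k] by linarith
    qed
    define z where "z = (1/2) *\<^sub>R (s m + s n)"
    let ?S = "\<lambda>\<omega>. norm (residual F (s n) \<omega>) powr p + norm (residual F (s m) \<omega>) powr p"
    let ?R = "\<lambda>\<omega>. \<kappa> * ?S \<omega> + C * (?S \<omega> / 2 - norm (residual F z \<omega>) powr p)"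
    note int = LfunD(2)[OF residual_Lfun[OF F]]
    have "(A * norm (s m - s n)) powr p \<le> Lnorm p M (\<lambda>\<omega>. \<Lambda> \<omega> (s m - s n)) powr p"
      using A p by (intro powr_mono2) auto
    also have "\<dots> = (\<integral>\<omega>. norm (\<Lambda> \<omega> (s m - s n)) powr p \<partial>completion M)"
      using p by (intro Lnorm_powr Lam_Lfun) auto
    also have "\<dots> \<le> (\<integral>\<omega>. ?R \<omega> \<partial>completion M)"
    proof (rule integral_mono)
      fix \<omega> assume "\<omega> \<in> space (completion M)"
      then have "\<Lambda> \<omega> (s m - s n) = residual F (s n) \<omega> - residual F (s m) \<omega>"
        and "residual F z \<omega> = (1/2) *\<^sub>R (residual F (s n) \<omega> + residual F (s m) \<omega>)"
        by (simp_all add: Lam_diff Lam_add Lam_scaleR residual_def z_def algebra_simps flip: scaleR_add_left)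
      then show "norm (\<Lambda> \<omega> (s m - s n)) powr p \<le> ?R \<omega>"
        using ineq by presburger
    qed (use int LfunD(2)[OF Lam_Lfun] in auto)
    also have "\<dots> = \<kappa> * (energy F (s n) + energy F (s m))
        + C * ((energy F (s n) + energy F (s m)) / 2 - energy F z)"
      unfolding energy_def using int by simp
    also have "\<dots> < \<eta>"
    proof -
      have h1: "?h \<le> 1" by (simp add: inverse_le_1_iff)
      have "energy F (s n) + energy F (s m) \<le> 2 * (\<bar>d\<bar> + 1)"
        using small[OF mn(1)] small[OF mn(2)] h1 abs_ge_self[of d] by argo
      then have "\<kappa> * (energy F (s n) + energy F (s m)) \<le> \<kappa> * (2 * (\<bar>d\<bar> + 1))"
        using \<kappa> by (intro mult_left_mono) auto
      also have "\<dots> = \<eta> / 2" unfolding \<kappa>_def using abs_ge_zero[of d] by (simp add: divide_simps)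
      finally have 1: "\<kappa> * (energy F (s n) + energy F (s m)) \<le> \<eta> / 2" .
      have "(energy F (s n) + energy F (s m)) / 2 - energy F z < \<eta> / (2 * C)"
        using small[OF mn(1)] small[OF mn(2)] lower[of z] N by argo
      then have "C * ((energy F (s n) + energy F (s m)) / 2 - energy F z) < C * (\<eta> / (2 * C))"
        using C by (intro mult_strict_left_mono) auto
      also have "\<dots> = \<eta> / 2" using C by simp
      finally show ?thesis using 1 by argo
    qed
    finally have lt: "(A * norm (s m - s n)) powr p < (A * e) powr p" by (simp add: \<eta>_def)
    show ?thesis
    proof (rule ccontr)
      assume "\<not> norm (s m - s n) < e"
      then have "A * e \<le> A * norm (s m - s n)" using A by simp
      then have "(A * e) powr p \<le> (A * norm (s m - s n)) powr p"
        using A e p by (intro powr_mono2) auto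
      with lt show False by simp
    qed
  qed
  then show "\<exists>N. \<forall>m\<ge>N. \<forall>n\<ge>N. norm (s m - s n) < e" by blast
qed

text \<open>
  The energy of the limit \<open>x\<close> of a minimizing sequence is compared with the energies along the
  sequence through the tangent at \<open>x\<close>, whose linear term tends to 0.
\<close>

lemma nearest_point:
  assumes F: "F \<in> Lfun p M"
  shows "\<exists>x. \<forall>y. energy F x \<le> energy F y"
proof -
  define d where "d = (INF y. energy F y)"
  have bdd: "bdd_below (range (energy F))" using energy_nonneg by (intro bdd_belowI[of _ 0]) auto
  have lower: "d \<le> energy F y" for y unfolding d_def by (intro cINF_lower bdd) auto
  have "\<exists>y. energy F y < d + inverse (real (Suc n))" for n
    using cInf_lessD[of "range (energy F)" "d + inverse (real (Suc n))"] by (auto simp: d_def)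
  then obtain s where s: "\<And>n. energy F (s n) < d + inverse (real (Suc n))" by metis
  have "Cauchy s" using F lower s by (rule energy_minimizing_Cauchy)
  then obtain x where x: "s \<longlonglongrightarrow> x" using Cauchy_convergent convergent_def by blast
  let ?\<phi> = "\<lambda>z. pair (\<lambda>\<omega>. \<Lambda> \<omega> z) (duality_map (residual F x))"
  have bl: "bounded_linear ?\<phi>" using pair_Lam_bounded_linear duality_map_in_Lfun residual_Lfun F by blast
  have "(\<lambda>n. energy F x + p * inner (?\<phi> (x - s n)) 1) \<longlonglongrightarrow> energy F x + p * inner (?\<phi> (x - x)) 1"
    by (intro tendsto_intros bounded_linear.tendsto[OF bl] x)
  moreover have "(\<lambda>n. d + inverse (real (Suc n))) \<longlonglongrightarrow> d + 0"
    by (intro tendsto_intros LIMSEQ_inverse_real_of_nat)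
  moreover have "\<exists>N. \<forall>n\<ge>N. energy F x + p * inner (?\<phi> (x - s n)) 1 \<le> d + inverse (real (Suc n))"
    using energy_subgradient[OF F, of x] s by (meson less_imp_le order_trans)
  ultimately have "energy F x + p * inner (?\<phi> (x - x)) 1 \<le> d + 0"
    by (rule LIMSEQ_le)
  moreover have "?\<phi> (x - x) = 0" using bounded_linear.linear[OF bl] linear_0 by force
  ultimately have "energy F x \<le> d" by simp
  then show ?thesis using lower order_trans by blast
qed

text \<open>
  Dominated convergence: the integrand is at most \<open>(|F - U x| + |U h|)\<^sup>p\<close> as long as the parameter
  lies in \<open>[0, 1]\<close>.
\<close>

lemma duality_map_residual_tendsto:
  assumes F: "F \<in> Lfun p M"
  shows "(\<lambda>n. pair (\<lambda>\<omega>. \<Lambda> \<omega> h) (duality_map (residual F (x + inverse (real (Suc n)) *\<^sub>R h))))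
    \<longlonglongrightarrow> pair (\<lambda>\<omega>. \<Lambda> \<omega> h) (duality_map (residual F x))"
  unfolding pair_def
proof (rule integral_dominated_convergence)
  let ?w = "\<lambda>\<omega>. 2 powr p * (norm (residual F x \<omega>) powr p + norm (\<Lambda> \<omega> h) powr p)"
  show "integrable (completion M) ?w"
    using LfunD(2)[OF residual_Lfun[OF F]] LfunD(2)[OF Lam_Lfun] by auto
  show "(\<lambda>\<omega>. \<nu> (duality_map (residual F x) \<omega>) (\<Lambda> \<omega> h)) \<in> borel_measurable (completion M)" for x
    using pair_integrable[OF Lam_Lfun duality_map_in_Lfun[OF residual_Lfun[OF F]]] by auto
  then show "(\<lambda>\<omega>. \<nu> (duality_map (residual F (x + inverse (real (Suc n)) *\<^sub>R h)) \<omega>) (\<Lambda> \<omega> h))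
    \<in> borel_measurable (completion M)" for n .
  show "AE \<omega> in completion M. (\<lambda>n. \<nu> (duality_map (residual F (x + inverse (real (Suc n)) *\<^sub>R h)) \<omega>) (\<Lambda> \<omega> h))
      \<longlonglongrightarrow> \<nu> (duality_map (residual F x) \<omega>) (\<Lambda> \<omega> h)"
  proof (rule AE_I2)
    fix \<omega> assume "\<omega> \<in> space (completion M)"
    then have sp: "\<omega> \<in> space M" by simp
    have "(\<lambda>n. residual F x \<omega> - inverse (real (Suc n)) *\<^sub>R \<Lambda> \<omega> h) \<longlonglongrightarrow> residual F x \<omega> - 0 *\<^sub>R \<Lambda> \<omega> h"
      by (intro tendsto_intros LIMSEQ_inverse_real_of_nat)
    then have "(\<lambda>n. residual F (x + inverse (real (Suc n)) *\<^sub>R h) \<omega>) \<longlonglongrightarrow> residual F x \<omega>"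
      by (simp add: residual_def Lam_add[OF sp] Lam_scaleR[OF sp] diff_diff_eq)
    then have "(\<lambda>n. duality_map (residual F (x + inverse (real (Suc n)) *\<^sub>R h)) \<omega>) \<longlonglongrightarrow> duality_map (residual F x) \<omega>"
      unfolding duality_map_def
      by (intro continuous_on_tendsto_compose[OF continuous_duality_map[OF p J_continuous norm_J]]) auto
    then show "(\<lambda>n. \<nu> (duality_map (residual F (x + inverse (real (Suc n)) *\<^sub>R h)) \<omega>) (\<Lambda> \<omega> h))
      \<longlonglongrightarrow> \<nu> (duality_map (residual F x) \<omega>) (\<Lambda> \<omega> h)"
      by (intro nu.tendsto tendsto_const)
  qed
  show "AE \<omega> in completion M. norm (\<nu> (duality_map (residual F (x + inverse (real (Suc n)) *\<^sub>R h)) \<omega>) (\<Lambda> \<omega> h)) \<le> ?w \<omega>" for n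
  proof (rule AE_I2)
    fix \<omega> assume "\<omega> \<in> space (completion M)"
    then have sp: "\<omega> \<in> space M" by simp
    define t where "t = inverse (real (Suc n))"
    have t: "0 \<le> t" "t \<le> 1" by (auto simp: t_def inverse_le_1_iff)
    let ?r = "norm (residual F (x + t *\<^sub>R h) \<omega>)" and ?a = "norm (residual F x \<omega>) + norm (\<Lambda> \<omega> h)"
    have "?r = norm (residual F x \<omega> - t *\<^sub>R \<Lambda> \<omega> h)"
      by (simp add: residual_def Lam_add[OF sp] Lam_scaleR[OF sp] diff_diff_eq)
    also have "\<dots> \<le> norm (residual F x \<omega>) + t * norm (\<Lambda> \<omega> h)"
      using norm_triangle_ineq4[of "residual F x \<omega>" "t *\<^sub>R \<Lambda> \<omega> h"] t by simp
    also have "\<dots> \<le> ?a" using mult_right_mono[OF t(2), of "norm (\<Lambda> \<omega> h)"] by simp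
    finally have r: "?r \<le> ?a" .
    have "norm (\<nu> (duality_map (residual F (x + t *\<^sub>R h)) \<omega>) (\<Lambda> \<omega> h))
        \<le> norm (duality_map (residual F (x + t *\<^sub>R h)) \<omega>) * norm (\<Lambda> \<omega> h)"
      by (rule norm_nu_le)
    also have "norm (duality_map (residual F (x + t *\<^sub>R h)) \<omega>) = ?r powr (p - 1)"
      by (simp add: duality_map_def norm_J powr_minus_two_mult)
    also have "?r powr (p - 1) * norm (\<Lambda> \<omega> h) \<le> ?a powr (p - 1) * ?a"
      using r p by (intro mult_mono powr_mono2) auto
    also have "\<dots> = ?a powr p"
      using powr_mult_base[of ?a "p - 1"] by (simp add: mult.commute)
    also have "\<dots> \<le> ?w \<omega>"
      using norm_add_powr_le[of p "norm (residual F x \<omega>)" "norm (\<Lambda> \<omega> h)"] p by simp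
    finally show "norm (\<nu> (duality_map (residual F (x + inverse (real (Suc n)) *\<^sub>R h)) \<omega>) (\<Lambda> \<omega> h)) \<le> ?w \<omega>"
      by (simp add: t_def)
  qed
qed

text \<open>
  The tangent inequality at \<open>x + t h\<close> bounds the real part of the pairing there by 0 for \<open>t > 0\<close>;
  now let \<open>t\<close> tend to 0.
\<close>

lemma first_variation:
  assumes F: "F \<in> Lfun p M" and min: "\<And>y. energy F x \<le> energy F y"
  shows "pair (\<lambda>\<omega>. \<Lambda> \<omega> h) (duality_map (residual F x)) = 0"
proof -
  let ?D = "duality_map (residual F x)"
  have D: "?D \<in> Lfun q M" using duality_map_in_Lfun residual_Lfun F by blast
  have le: "inner (pair (\<lambda>\<omega>. \<Lambda> \<omega> h) ?D) 1 \<le> 0" for h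
  proof (rule LIMSEQ_le_const2)
    show "(\<lambda>n. inner (pair (\<lambda>\<omega>. \<Lambda> \<omega> h) (duality_map (residual F (x + inverse (real (Suc n)) *\<^sub>R h)))) 1)
      \<longlonglongrightarrow> inner (pair (\<lambda>\<omega>. \<Lambda> \<omega> h) ?D) 1"
      by (intro tendsto_intros duality_map_residual_tendsto[OF F])
    have "inner (pair (\<lambda>\<omega>. \<Lambda> \<omega> h) (duality_map (residual F (x + inverse (real (Suc n)) *\<^sub>R h)))) 1 \<le> 0" for n
    proof -
      define t where "t = inverse (real (Suc n))"
      have t: "0 < t" by (simp add: t_def)
      let ?c = "pair (\<lambda>\<omega>. \<Lambda> \<omega> h) (duality_map (residual F (x + t *\<^sub>R h)))"
      \<comment> \<open>The tangent is taken at \<open>x + t h\<close> and evaluated at the minimizer \<open>x\<close>.\<close>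
      have "pair (\<lambda>\<omega>. \<Lambda> \<omega> (x + t *\<^sub>R h - x)) (duality_map (residual F (x + t *\<^sub>R h))) = t *\<^sub>R ?c"
        using pair_Lam_scaleR[OF duality_map_in_Lfun[OF residual_Lfun[OF F]], of t h "x + t *\<^sub>R h"] by simp
      then have "p * (t * inner ?c 1) \<le> 0"
        using energy_subgradient[OF F, of "x + t *\<^sub>R h" x] min[of "x + t *\<^sub>R h"] by simp
      then show ?thesis using p t unfolding t_def[symmetric] by (simp add: mult_le_0_iff)
    qed
    then show "\<exists>N. \<forall>n\<ge>N. inner (pair (\<lambda>\<omega>. \<Lambda> \<omega> h) (duality_map (residual F (x + inverse (real (Suc n)) *\<^sub>R h)))) 1 \<le> 0"
      by blast
  qed
  \<comment> \<open>Only the real part is under control, but scaling \<open>h\<close> by \<open>inverse ?c\<close> would make the value 1.\<close>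
  show ?thesis
  proof (rule ccontr)
    let ?c = "pair (\<lambda>\<omega>. \<Lambda> \<omega> h) ?D"
    assume nz: "?c \<noteq> 0"
    have "inner (inverse ?c * ?c) 1 \<le> 0"
      using le[of "scX (inverse ?c) h"] by (simp only: pair_Lam_linear(2)[OF D])
    then show False using nz by (simp add: dot_square_norm)
  qed
qed

section \<open>The equivalences\<close>

lemma analysis_surj_if_synthesis_inj:
  assumes inj: "inj_on (synthesis M \<nu> \<Lambda>) (Lspace q M)"
  shows "range (analysis p q M \<nu> \<Lambda>) = Lspace p M"
proof (rule subset_antisym)
  show "range (analysis p q M \<nu> \<Lambda>) \<subseteq> Lspace p M"
    by (auto simp: analysis_eq intro: Lclass_in_Lspace Lam_Lfun)
  show "Lspace p M \<subseteq> range (analysis p q M \<nu> \<Lambda>)"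
  proof
    fix \<F> :: "('w \<Rightarrow> 'k) set" assume "\<F> \<in> Lspace p M"
    then obtain F where F: "F \<in> Lfun p M" "\<F> = Lclass p M F" by (rule LspaceE)
    obtain x where x: "\<And>y. energy F x \<le> energy F y" using nearest_point[OF F(1)] by blast
    let ?D = "duality_map (residual F x)"
    have D: "?D \<in> Lfun q M" using duality_map_in_Lfun residual_Lfun F by blast
    have "synthesis M \<nu> \<Lambda> (Lclass q M ?D) = synthesis M \<nu> \<Lambda> (Lclass q M (\<lambda>\<omega>. 0))"
      unfolding synthesis_Lclass[OF D] synthesis_Lclass[OF zero_in_Lfun] first_variation[OF F(1) x]
      by (simp add: pair_def nu.zero_left)
    then have "Lclass q M ?D = Lclass q M (\<lambda>\<omega>. 0)"
      by (rule inj_onD[OF inj]) (simp_all add: Lclass_in_Lspace D zero_in_Lfun)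
    then have "AE \<omega> in M. ?D \<omega> = 0" using Lclass_eq_iff[OF D zero_in_Lfun] by simp
    then have "AE \<omega> in M. F \<omega> = \<Lambda> \<omega> x"
    proof eventually_elim
      case (elim \<omega>)
      then have "norm (residual F x \<omega>) powr (p - 1) = 0"
        by (metis duality_map_def norm_J norm_scaleR abs_of_nonneg
          powr_ge_zero powr_minus_two_mult(1) norm_ge_zero norm_zero)
      then show ?case by (simp add: residual_def)
    qed
    then show "\<F> \<in> range (analysis p q M \<nu> \<Lambda>)"
      using F by (auto simp: analysis_eq Lclass_eq_iff Lam_Lfun)
  qed
qed

text \<open>
  Let \<open>U x\<close> be the class of \<open>F = |G|\<^sup>q\<^sup>-\<^sup>2 J\<^sup>-\<^sup>1 G\<close>, and let \<open>S\<close> be the integral of \<open>|G|\<^sup>q\<close>, which is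
  also the integral of \<open>|F|\<^sup>p\<close>. Then \<open>(T G) x = S\<close> and \<open>A \<parallel>x\<parallel> \<le> S\<^sup>1\<^sup>/\<^sup>p\<close>, so \<open>\<parallel>T G\<parallel>\<close> is at least
  \<open>A S\<^sup>1\<^sup>-\<^sup>1\<^sup>/\<^sup>p = A \<parallel>G\<parallel>\<close>.
\<close>

lemma synthesis_lower_bound:
  assumes surj: "range (analysis p q M \<nu> \<Lambda>) = Lspace p M"
    and A: "0 < A" "\<And>x. A * norm x \<le> Lnorm p M (\<lambda>\<omega>. \<Lambda> \<omega> x)"
    and G: "G \<in> Lfun q M"
  shows "A * Lnorm q M G \<le> onorm (\<lambda>x. pair (\<lambda>\<omega>. \<Lambda> \<omega> x) G)"
proof -
  let ?\<phi> = "\<lambda>x. pair (\<lambda>\<omega>. \<Lambda> \<omega> x) G"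
  note bl = pair_Lam_bounded_linear[OF G]
  define F where "F \<omega> = norm (G \<omega>) powr (q - 2) *\<^sub>R J_inv (G \<omega>)" for \<omega>
  define S where "S = (\<integral>\<omega>. norm (G \<omega>) powr q \<partial>completion M)"
  have F: "F \<in> Lfun p M"
    unfolding F_def[abs_def] using duality_map_Lfun[OF q qp G J_inv_continuous norm_J_inv] .
  have "norm (F \<omega>) powr p = norm (G \<omega>) powr q" for \<omega>
    unfolding F_def by (rule duality_map_norm_powr[OF q qp norm_J_inv])
  then have nF: "Lnorm p M F = S powr (1 / p)"
    unfolding Lnorm_eq_integral[OF F] S_def by simp
  have nG: "Lnorm q M G = S powr (1 / q)"
    unfolding Lnorm_eq_integral[OF G] S_def ..
  have "Lclass p M F \<in> range (analysis p q M \<nu> \<Lambda>)"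
    unfolding surj by (rule Lclass_in_Lspace[OF F])
  then obtain x where "Lclass p M F = Lclass p M (\<lambda>\<omega>. \<Lambda> \<omega> x)" by (auto simp: analysis_eq)
  then have ae: "AE \<omega> in M. F \<omega> = \<Lambda> \<omega> x" using Lclass_eq_iff[OF F Lam_Lfun] by simp
  have "?\<phi> x = pair F G"
    using ae by (intro pair_AE_cong Lam_Lfun F G) (auto elim: eventually_mono)
  also have "\<dots> = (\<integral>\<omega>. norm (G \<omega>) powr q *\<^sub>R 1 \<partial>completion M)"
    unfolding pair_def F_def nu.scaleR_right nu_J_inv_self
    by (simp add: of_real_def powr_minus_two_mult del: of_real_power)
  also have "\<dots> = S *\<^sub>R 1" using LfunD[OF G] by (simp add: S_def)
  finally have \<phi>x: "norm (?\<phi> x) = S" using integral_nonneg_AE[of "\<lambda>\<omega>. norm (G \<omega>) powr q" "completion M"]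
    by (simp add: S_def)
  have "A * S \<le> A * (onorm ?\<phi> * norm x)"
    using onorm[OF bl, of x] \<phi>x A by (intro mult_left_mono) auto
  also have "\<dots> = onorm ?\<phi> * (A * norm x)" by simp
  also have "\<dots> \<le> onorm ?\<phi> * S powr (1 / p)"
    using A(2)[of x] Lnorm_AE_cong[OF ae, of p] nF
    by (intro mult_left_mono onorm_pos_le bl) auto
  finally have main: "A * S \<le> onorm ?\<phi> * S powr (1 / p)" .
  show ?thesis
  proof (cases "S = 0")
    case True
    then show ?thesis using nG onorm_pos_le[OF bl] by simp
  next
    case False
    then have S: "0 < S" using \<phi>x by (metis norm_ge_zero order_le_less)
    have "S powr (1 / p) * S powr (1 / q) = S"
      using S pq by (simp flip: powr_add)
    then have "S powr (1 / p) * (A * S powr (1 / q)) \<le> S powr (1 / p) * onorm ?\<phi>"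
      using main by (simp add: algebra_simps)
    then show ?thesis unfolding nG using S by (simp add: mult_le_cancel_left_pos)
  qed
qed

lemma Lam_AE_zero_iff: "{x. AE \<omega> in M. \<Lambda> \<omega> x = 0} = {0}"
proof -
  obtain A where A: "0 < A" "\<And>x. A * norm x \<le> Lnorm p M (\<lambda>\<omega>. \<Lambda> \<omega> x)"
    using frame_bounds by metis
  have "x = 0" if "AE \<omega> in M. \<Lambda> \<omega> x = 0" for x
  proof -
    have "Lnorm p M (\<lambda>\<omega>. \<Lambda> \<omega> x) = 0"
      using Lnorm_AE_cong[OF that, of p] p by (simp add: Lnorm_eq_integral[OF zero_in_Lfun])
    then have "A * norm x \<le> 0" using A(2)[of x] by simp
    then show ?thesis using A(1) by (simp add: mult_le_0_iff)
  qed
  moreover have "AE \<omega> in M. \<Lambda> \<omega> 0 = 0" by (rule AE_I2) (rule Lam_zero)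
  ultimately show ?thesis by auto
qed

lemma riesz_basis_if_analysis_surj:
  assumes surj: "range (analysis p q M \<nu> \<Lambda>) = Lspace p M"
  shows "bochner_qg_riesz_basis q M scX scK H \<nu> \<Lambda>"
proof -
  obtain A B where AB: "0 < A" "0 < B" "\<And>x. A * norm x \<le> Lnorm p M (\<lambda>\<omega>. \<Lambda> \<omega> x)"
    "\<And>x. Lnorm p M (\<lambda>\<omega>. \<Lambda> \<omega> x) \<le> B * norm x"
    using frame_bounds by metis
  have "synthesis_well_defined q M scX \<nu> \<Lambda>"
    unfolding synthesis_well_defined_def
    by (auto simp: synthesis_Lclass pair_Lam_in_dual_space intro: pair_integrable Lam_Lfun elim!: LspaceE)
  moreover have "A * Lnorm q M (rep \<G>) \<le> onorm (synthesis M \<nu> \<Lambda> \<G>) \<and>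
      onorm (synthesis M \<nu> \<Lambda> \<G>) \<le> B * Lnorm q M (rep \<G>)" if mem: "\<G> \<in> Lspace q M" for \<G>
  proof -
    obtain G where G: "G \<in> Lfun q M" "\<G> = Lclass q M G" using mem by (rule LspaceE)
    have "onorm (\<lambda>x. pair (\<lambda>\<omega>. \<Lambda> \<omega> x) G) \<le> B * Lnorm q M G"
    proof (rule onorm_bound)
      show "norm (pair (\<lambda>\<omega>. \<Lambda> \<omega> x) G) \<le> B * Lnorm q M G * norm x" for x
        using norm_pair_le[OF Lam_Lfun G(1), of x] mult_right_mono[OF AB(4) Lnorm_nonneg, of x q M G]
        by (simp add: algebra_simps)
    qed (simp add: AB(2) less_imp_le Lnorm_nonneg)
    then show ?thesis
      using synthesis_lower_bound[OF surj AB(1,3) G(1)]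
      by (simp add: G(2) synthesis_Lclass[OF G(1)] Lnorm_rep_Lclass[OF G(1)])
  qed
  ultimately show ?thesis
    using frame Lam_AE_zero_iff AB(1,2) unfolding bochner_qg_riesz_basis_def bochner_pg_frame_def by blast
qed

lemma synthesis_inj_if_riesz_basis:
  assumes "bochner_qg_riesz_basis q M scX scK H \<nu> \<Lambda>"
  shows "inj_on (synthesis M \<nu> \<Lambda>) (Lspace q M)"
proof (rule inj_onI)
  obtain A where A: "0 < A" "\<And>\<G>. \<G> \<in> Lspace q M \<Longrightarrow> A * Lnorm q M (rep \<G>) \<le> onorm (synthesis M \<nu> \<Lambda> \<G>)"
    using assms by (auto simp: bochner_qg_riesz_basis_def)
  fix \<G> \<G>' assume mem: "\<G> \<in> Lspace q M" "\<G>' \<in> Lspace q M" and eq: "synthesis M \<nu> \<Lambda> \<G> = synthesis M \<nu> \<Lambda> \<G>'"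
  obtain G where "G \<in> Lfun q M" "\<G> = Lclass q M G" using mem(1) by (rule LspaceE)
  moreover obtain G' where "G' \<in> Lfun q M" "\<G>' = Lclass q M G'" using mem(2) by (rule LspaceE)
  ultimately have G: "G \<in> Lfun q M" "\<G> = Lclass q M G" "G' \<in> Lfun q M" "\<G>' = Lclass q M G'" .
  define D where "D \<omega> = G \<omega> - G' \<omega>" for \<omega>
  have D: "D \<in> Lfun q M" unfolding D_def[abs_def] using q G by (intro Lfun_diff) auto
  have "pair (\<lambda>\<omega>. \<Lambda> \<omega> x) D = 0" for x
    using fun_cong[OF eq, of x] G pair_diff_right[OF Lam_Lfun G(1,3), of x]
    by (simp add: synthesis_Lclass D_def[abs_def])
  then have "onorm (synthesis M \<nu> \<Lambda> (Lclass q M D)) = 0"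
    by (simp add: synthesis_Lclass[OF D] onorm_zero)
  then have "A * Lnorm q M D \<le> 0"
    using A(2)[OF Lclass_in_Lspace[OF D]] by (simp add: Lnorm_rep_Lclass[OF D])
  then have "Lnorm q M D = 0" using A(1) Lnorm_nonneg[of q M D] by (simp add: mult_le_0_iff)
  then have "(\<integral>\<omega>. norm (D \<omega>) powr q \<partial>completion M) = 0"
    using Lnorm_powr[OF D] q by simp
  then have "AE \<omega> in M. D \<omega> = 0" by (rule Lfun_AE_zero[OF D])
  then show "\<G> = \<G>'" using G by (simp add: Lclass_eq_iff D_def)
qed

end

theorem theorem3p3:
  fixes scX :: "'f::{real_normed_field,euclidean_space} \<Rightarrow> 'x::banach \<Rightarrow> 'x"
    and scK :: "'f \<Rightarrow> 'k::banach \<Rightarrow> 'k"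
    and ip :: "'k \<Rightarrow> 'k \<Rightarrow> 'f"
    and H :: "'w \<Rightarrow> 'k set"
    and \<nu> :: "'k \<Rightarrow> 'k \<Rightarrow> 'f"
    and M :: "'w measure"
    and \<Lambda> :: "'w \<Rightarrow> 'x \<Rightarrow> 'k"
    and p q :: real
  assumes "normed_space_over scX"
    and "hilbert_space_over scK ip"
    and "hilbert_direct_sum scK ip (space M) H"
    and "isometric_dual_isomorphism scK \<nu>"
    and "sigma_finite_measure M"
    and "1 < p"
    and "1 / p + 1 / q = 1"
    and "bochner_pg_frame p M scX scK H \<Lambda>"
  shows "(bochner_qg_riesz_basis q M scX scK H \<nu> \<Lambda> \<longleftrightarrow>
            inj_on (synthesis M \<nu> \<Lambda>) (Lspace q M)) \<and>
         (inj_on (synthesis M \<nu> \<Lambda>) (Lspace q M) \<longleftrightarrow>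
            range (analysis p q M \<nu> \<Lambda>) = Lspace p M)"
proof -
  interpret pg_frame scX scK ip \<nu> M H \<Lambda> p q
    by (intro pg_frame.intro hilbert_duality.intro hilbert_duality_axioms.intro pg_frame_axioms.intro assms)
  show ?thesis
    using analysis_surj_if_synthesis_inj riesz_basis_if_analysis_surj synthesis_inj_if_riesz_basis
    by blast
qed

end
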